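(* Let $\Omega$ be a Polish space and $(T(t))_{t\ge0}\subset\mathscr{L}(\mathscr{M}(\Omega),\sigma)$ a stochastically continuous Markovian semigroup, and let $\mu\in\mathscr{M}(\Omega)$ be an invariant probability measure ($T(t)\mu=\mu$ for all $t\ge0$). If the semigroup is $t_0$-regular for some $t_0>0$, then \[\lim_{t\to\infty}T(t)\nu=\nu(\Omega)\,\mu\] in the total variation norm of $\mathscr{M}(\Omega)$ for every $\nu\in\mathscr{M}(\Omega)$. Moreover, $\mu$ is the unique invariant probability measure, and $\mu$ is equivalent to $k_t(x,\cdot)$ for all $t\ge t_0$ and $x\in\Omega$.
   Context: $\mathscr{M}(\Omega)$: finite signed Borel measures with total variation norm. A weakly continuous operator is one of the form $(T\mu)(A)=\int k(x,A)\,d\mu(x)$ with $k$ a bounded transition kernel (map $\Omega\times\mathscr{B}(\Omega)\to\mathbb{R}$, signed measure in the second variable, Borel measurable in the first, $\sup_x\lvert k\rvert(x,\Omega)<\infty$); $\mathscr{L}(\mathscr{M}(\Omega),\sigma)$ is the space of such operators. A semigroup $(T(t))_{t\ge0}$ satisfies $T(0)=I$, $T(t+s)=T(t)T(s)$; $k_t$ denotes the kernel of $T(t)$. It is Markovian if each $k_t(x,\cdot)$ is a probability measure; stochastically continuous if $\lim_{t\to0}\int_\Omega f(y)\,k_t(x,dy)=f(x)$ for all bounded continuous $f$ and all $x\in\Omega$; $t_0$-regular ($t_0>0$) if $k_{t_0}(x,\cdot)$ and $k_{t_0}(y,\cdot)$ are equivalent for all $x,y\in\Omega$. *)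

theory Defs
  imports "HOL-Analysis.Analysis"
begin

text \<open>Finite signed Borel measures on a topological space, represented as real-valued
  set functions that are countably additive on the Borel sets (values on non-Borel sets
  are irrelevant and never used).\<close>
definition signed_measure :: "('a::topological_space set \<Rightarrow> real) \<Rightarrow> bool" where
  "signed_measure \<mu> \<longleftrightarrow> \<mu> {} = 0 \<and>
     (\<forall>A::nat \<Rightarrow> 'a set. range A \<subseteq> sets borel \<longrightarrow> disjoint_family A \<longrightarrow>
        (\<lambda>n. \<mu> (A n)) sums \<mu> (\<Union>n. A n))"

definition tv_norm :: "('a::topological_space set \<Rightarrow> real) \<Rightarrow> real" where
  "tv_norm \<mu> = Sup {(\<Sum>i<n. \<bar>\<mu> (A i)\<bar>) | (n::nat) A.
       (\<forall>i<n. A i \<in> sets borel) \<and> disjoint_family_on A {..<n}}"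

definition pos_var :: "('a::topological_space set \<Rightarrow> real) \<Rightarrow> 'a set \<Rightarrow> real" where
  "pos_var \<mu> A = Sup {\<mu> B | B. B \<in> sets borel \<and> B \<subseteq> A}"

definition pos_var_measure :: "('a::topological_space set \<Rightarrow> real) \<Rightarrow> 'a measure" where
  "pos_var_measure \<mu> = measure_of UNIV (sets borel) (\<lambda>A. ennreal (pos_var \<mu> A))"

text \<open>Integral of f with respect to a signed measure, via the Jordan decomposition
  mu = mu^+ - mu^-.\<close>
definition signed_integral :: "('a::topological_space set \<Rightarrow> real) \<Rightarrow> ('a \<Rightarrow> real) \<Rightarrow> real" where
  "signed_integral \<mu> f =
     (\<integral>x. f x \<partial>pos_var_measure \<mu>) - (\<integral>x. f x \<partial>pos_var_measure (\<lambda>A. - \<mu> A))"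

definition bounded_kernel :: "('a::topological_space \<Rightarrow> 'a set \<Rightarrow> real) \<Rightarrow> bool" where
  "bounded_kernel k \<longleftrightarrow> (\<forall>x. signed_measure (k x)) \<and>
     (\<forall>A \<in> sets borel. (\<lambda>x. k x A) \<in> borel_measurable borel) \<and>
     (\<exists>C. \<forall>x. tv_norm (k x) \<le> C)"

definition kernel_op :: "('a::topological_space \<Rightarrow> 'a set \<Rightarrow> real) \<Rightarrow>
    ('a set \<Rightarrow> real) \<Rightarrow> 'a set \<Rightarrow> real" where
  "kernel_op k \<mu> A = signed_integral \<mu> (\<lambda>x. k x A)"

definition prob_signed_measure :: "('a::topological_space set \<Rightarrow> real) \<Rightarrow> bool" where
  "prob_signed_measure \<mu> \<longleftrightarrow> signed_measure \<mu> \<and> (\<forall>A \<in> sets borel. \<mu> A \<ge> 0) \<and> \<mu> UNIV = 1"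

definition equivalent_measures :: "('a::topological_space set \<Rightarrow> real) \<Rightarrow> ('a set \<Rightarrow> real) \<Rightarrow> bool" where
  "equivalent_measures \<mu> \<nu> \<longleftrightarrow> (\<forall>A \<in> sets borel. \<mu> A = 0 \<longleftrightarrow> \<nu> A = 0)"

text \<open>Semigroup (T(t))_{t\<ge>0} in L(M(Omega),sigma), given by its kernels k t.\<close>
definition kernel_semigroup :: "(real \<Rightarrow> 'a::topological_space \<Rightarrow> 'a set \<Rightarrow> real) \<Rightarrow> bool" where
  "kernel_semigroup k \<longleftrightarrow>
     (\<forall>t\<ge>0. bounded_kernel (k t)) \<and>
     (\<forall>\<nu>. signed_measure \<nu> \<longrightarrow> (\<forall>A \<in> sets borel. kernel_op (k 0) \<nu> A = \<nu> A)) \<and>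
     (\<forall>t\<ge>0. \<forall>s\<ge>0. \<forall>\<nu>. signed_measure \<nu> \<longrightarrow> (\<forall>A \<in> sets borel.
         kernel_op (k (t + s)) \<nu> A = kernel_op (k t) (kernel_op (k s) \<nu>) A))"

definition markovian :: "(real \<Rightarrow> 'a::topological_space \<Rightarrow> 'a set \<Rightarrow> real) \<Rightarrow> bool" where
  "markovian k \<longleftrightarrow> (\<forall>t\<ge>0. \<forall>x. prob_signed_measure (k t x))"

definition stoch_continuous :: "(real \<Rightarrow> 'a::topological_space \<Rightarrow> 'a set \<Rightarrow> real) \<Rightarrow> bool" where
  "stoch_continuous k \<longleftrightarrow> (\<forall>f::'a \<Rightarrow> real. continuous_on UNIV f \<longrightarrow> bounded (range f) \<longrightarrow>
     (\<forall>x. ((\<lambda>t. signed_integral (k t x) f) \<longlongrightarrow> f x) (at_right 0)))"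

definition regular_at :: "(real \<Rightarrow> 'a::topological_space \<Rightarrow> 'a set \<Rightarrow> real) \<Rightarrow> real \<Rightarrow> bool" where
  "regular_at k t0 \<longleftrightarrow> (\<forall>x y. equivalent_measures (k t0 x) (k t0 y))"

definition invariant_measure :: "(real \<Rightarrow> 'a::topological_space \<Rightarrow> 'a set \<Rightarrow> real) \<Rightarrow> ('a set \<Rightarrow> real) \<Rightarrow> bool" where
  "invariant_measure k \<mu> \<longleftrightarrow> (\<forall>t\<ge>0. \<forall>A \<in> sets borel. kernel_op (k t) \<mu> A = \<mu> A)"

end

theory Submission
  imports Defs
begin

text \<open>
  Let \<open>P = T(t0)\<close>. Invariance and regularity give \<open>\<mu> \<sim> k\<^sub>t\<^sub>0(x,\<cdot>)\<close> for all \<open>x\<close>, so \<open>P\<close> maps every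
  signed measure to one that is absolutely continuous with respect to \<open>\<mu>\<close>. As \<open>T(t)\<close> is a contraction
  fixing \<open>\<mu>\<close>, truncating the density reduces the convergence to signed measures \<open>\<nu>\<close> with
  \<open>\<nu>(\<Omega>) = 0\<close> and \<open>\<bar>\<nu>\<bar> \<le> C\<mu>\<close>, and to the iterates of \<open>P\<close>; these conditions are preserved by \<open>P\<close>.
  For such \<open>\<nu>\<close> let \<open>D(\<nu>) = \<nu>\<^sup>+(\<Omega>)\<close>. If \<open>D(P\<nu>)\<close> is close to \<open>D(\<nu>) \<ge> m > 0\<close>, some set \<open>A\<close> has
  \<open>k\<^sub>t\<^sub>0(x,A)\<close> close to 1 for most \<open>x\<close> under \<open>\<nu>\<^sup>+\<close> and close to 0 for most \<open>x\<close> under \<open>\<nu>\<^sup>-\<close>, hence both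
  on sets of \<open>\<mu>\<close>-measure at least \<open>m/(2C)\<close>. A Borel-Cantelli argument shows that regularity forbids
  this below some uniform threshold, so \<open>D\<close> drops by a fixed amount at each step as long as it is at
  least \<open>m\<close>.
\<close>

section \<open>Jordan decomposition of finite signed measures\<close>

lemma signed_measure_empty: "signed_measure \<nu> \<Longrightarrow> \<nu> {} = 0"
  by (simp add: signed_measure_def)

lemma signed_measure_sums:
  "signed_measure \<nu> \<Longrightarrow> (\<And>n::nat. A n \<in> sets borel) \<Longrightarrow> disjoint_family A \<Longrightarrow>
    (\<lambda>n. \<nu> (A n)) sums \<nu> (\<Union>n. A n)"
  unfolding signed_measure_def by blast

lemma signed_measure_Un:
  assumes "signed_measure \<nu>" "A \<in> sets borel" "B \<in> sets borel" "A \<inter> B = {}"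
  shows "\<nu> (A \<union> B) = \<nu> A + \<nu> B"
proof -
  have "(\<lambda>n. \<nu> (binaryset A B n)) sums \<nu> (\<Union>n. binaryset A B n)"
  proof (rule signed_measure_sums[OF assms(1)])
    show "binaryset A B n \<in> sets borel" for n
      using assms by (simp add: binaryset_def)
    show "disjoint_family (binaryset A B)"
      using assms(4) by (auto simp: disjoint_family_on_def binaryset_def)
  qed
  moreover have "(\<lambda>n. \<nu> (binaryset A B n)) sums (\<nu> A + \<nu> B)"
    by (rule binaryset_sums) (rule signed_measure_empty[OF assms(1)])
  ultimately show ?thesis
    by (simp add: UN_binaryset_eq sums_unique2)
qed

lemma signed_measure_Diff:
  assumes "signed_measure \<nu>" "A \<in> sets borel" "B \<in> sets borel" "B \<subseteq> A"
  shows "\<nu> (A - B) = \<nu> A - \<nu> B"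
proof -
  have "\<nu> ((A - B) \<union> B) = \<nu> (A - B) + \<nu> B"
    using assms by (intro signed_measure_Un) auto
  moreover have "(A - B) \<union> B = A" using assms(4) by auto
  ultimately show ?thesis by simp
qed

lemma signed_measure_lincomb:
  assumes "signed_measure \<nu>" "signed_measure \<rho>"
  shows "signed_measure (\<lambda>A. a * \<nu> A + b * \<rho> A)"
  using assms unfolding signed_measure_def by (auto intro!: sums_add sums_mult)

lemma signed_measure_minus: "signed_measure \<nu> \<Longrightarrow> signed_measure (\<lambda>A. - \<nu> A)"
  unfolding signed_measure_def by (auto intro!: sums_minus)

lemma signed_measure_bounded:
  assumes \<nu>: "signed_measure \<nu>"
  shows "\<exists>M. \<forall>B\<in>sets borel. \<bar>\<nu> B\<bar> \<le> M"
proof (rule ccontr)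
  \<comment> \<open>A set of unbounded variation splits into a part of mass at least 1 and a part that again has
    unbounded variation; iterating gives disjoint sets whose masses do not tend to 0.\<close>
  define U where "U A \<longleftrightarrow> A \<in> sets borel \<and> (\<forall>M. \<exists>B\<in>sets borel. B \<subseteq> A \<and> \<bar>\<nu> B\<bar> > M)" for A
  assume "\<not> (\<exists>M. \<forall>B\<in>sets borel. \<bar>\<nu> B\<bar> \<le> M)"
  then have U0: "U UNIV" by (force simp: U_def not_le)
  have split: "\<exists>A'. U A' \<and> A' \<subseteq> A \<and> \<bar>\<nu> (A - A')\<bar> \<ge> 1" if "U A" for A
  proof -
    have A: "A \<in> sets borel" using that by (simp add: U_def)
    have U_witness: "\<exists>B\<in>sets borel. B \<subseteq> A \<and> \<bar>\<nu> B\<bar> > M" for M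
      using that by (simp add: U_def)
    \<comment> \<open>The surplus \<open>1 + \<bar>\<nu> A\<bar>\<close> makes
      \<open>\<bar>\<nu> B\<bar>\<close> and, by subtraction,
      \<open>\<bar>\<nu> (A - B)\<bar>\<close> exceed 1, so either half may be the one that inherits
      \<open>U\<close>.\<close>
    obtain B where B: "B \<in> sets borel" "B \<subseteq> A" "\<bar>\<nu> B\<bar> > 1 + \<bar>\<nu> A\<bar>"
      using U_witness[of "1 + \<bar>\<nu> A\<bar>"] by auto
    have d: "\<nu> (A - B) = \<nu> A - \<nu> B" using \<nu> A B by (intro signed_measure_Diff)
    have "U B \<or> U (A - B)"
    proof (rule ccontr)
      assume "\<not> (U B \<or> U (A - B))"
      then obtain M1 M2 where
        M1: "\<And>D. D \<in> sets borel \<Longrightarrow> D \<subseteq> B \<Longrightarrow> \<bar>\<nu> D\<bar> \<le> M1" and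
        M2: "\<And>D. D \<in> sets borel \<Longrightarrow> D \<subseteq> A - B \<Longrightarrow> \<bar>\<nu> D\<bar> \<le> M2"
        using A B unfolding U_def not_less by (metis linorder_not_less sets.Diff)
      obtain D where D: "D \<in> sets borel" "D \<subseteq> A" "\<bar>\<nu> D\<bar> > M1 + M2"
        using U_witness[of "M1 + M2"] by auto
      have "\<nu> ((D \<inter> B) \<union> (D - B)) = \<nu> (D \<inter> B) + \<nu> (D - B)"
        using \<nu> D B by (intro signed_measure_Un) auto
      moreover have "(D \<inter> B) \<union> (D - B) = D" by auto
      moreover have "\<bar>\<nu> (D \<inter> B)\<bar> \<le> M1" "\<bar>\<nu> (D - B)\<bar> \<le> M2"
        using D B by (auto intro!: M1 M2)
      ultimately show False using D(3) by simp
    qed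
    then show ?thesis
    proof
      assume "U B"
      then show ?thesis using B d by (intro exI[of _ B]) auto
    next
      assume "U (A - B)"
      moreover have "A - (A - B) = B" using B by auto
      ultimately show ?thesis using B by (intro exI[of _ "A - B"]) auto
    qed
  qed
  have "\<exists>F. \<forall>n. U (F n) \<and> (F (Suc n) \<subseteq> F n \<and> \<bar>\<nu> (F n - F (Suc n))\<bar> \<ge> 1)"
    by (rule dependent_nat_choice) (use U0 split in auto)
  then obtain F where "\<forall>n. U (F n) \<and> (F (Suc n) \<subseteq> F n \<and> \<bar>\<nu> (F n - F (Suc n))\<bar> \<ge> 1)" ..
  then have F: "\<And>n. U (F n)" "\<And>n. F (Suc n) \<subseteq> F n \<and> \<bar>\<nu> (F n - F (Suc n))\<bar> \<ge> 1"
    by simp_all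
  have mono: "F n \<subseteq> F m" if "m \<le> n" for m n
    using that by (induction rule: dec_induct) (use F(2) in auto)
  have "(\<lambda>n. \<nu> (F n - F (Suc n))) sums \<nu> (\<Union>n. F n - F (Suc n))"
  proof (rule signed_measure_sums[OF \<nu>])
    show "F n - F (Suc n) \<in> sets borel" for n using F(1) by (auto simp: U_def)
    have "(F m - F (Suc m)) \<inter> (F n - F (Suc n)) = {}" if "m < n" for m n
      using mono[of "Suc m" n] that by auto
    then show "disjoint_family (\<lambda>n. F n - F (Suc n))"
      unfolding disjoint_family_on_def by (metis inf_commute linorder_neqE_nat)
  qed
  then have "(\<lambda>n. \<nu> (F n - F (Suc n))) \<longlonglongrightarrow> 0"
    by (intro summable_LIMSEQ_zero) (rule sums_summable)
  then obtain n where "\<bar>\<nu> (F n - F (Suc n))\<bar> < 1"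
    unfolding LIMSEQ_iff by (metis diff_zero le_refl real_norm_def zero_less_one)
  then show False using F(2)[of n] by simp
qed

section \<open>Positive variation and its countable additivity\<close>

lemma pos_var_upper:
  assumes "signed_measure \<nu>" "B \<in> sets borel" "B \<subseteq> A"
  shows "\<nu> B \<le> pos_var \<nu> A"
proof -
  obtain M where M: "\<And>B. B \<in> sets borel \<Longrightarrow> \<bar>\<nu> B\<bar> \<le> M"
    using signed_measure_bounded[OF assms(1)] by blast
  have "bdd_above {\<nu> B | B. B \<in> sets borel \<and> B \<subseteq> A}"
    using M by (intro bdd_aboveI[of _ M]) (auto intro: order_trans[OF abs_ge_self])
  then show ?thesis
    unfolding pos_var_def using assms by (intro cSup_upper) auto
qed

lemma pos_var_least:
  assumes "\<And>B. B \<in> sets borel \<Longrightarrow> B \<subseteq> A \<Longrightarrow> \<nu> B \<le> c"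
  shows "pos_var \<nu> A \<le> c"
  unfolding pos_var_def using assms by (intro cSup_least) auto

lemma pos_var_nonneg: "signed_measure \<nu> \<Longrightarrow> 0 \<le> pos_var \<nu> A"
  using pos_var_upper[of \<nu> "{}" A] by (simp add: signed_measure_empty)

lemma pos_var_mono: "signed_measure \<nu> \<Longrightarrow> A \<subseteq> B \<Longrightarrow> pos_var \<nu> A \<le> pos_var \<nu> B"
  by (rule pos_var_least) (auto intro: pos_var_upper)

lemma pos_var_empty: "signed_measure \<nu> \<Longrightarrow> pos_var \<nu> {} = 0"
  by (intro antisym pos_var_nonneg pos_var_least) (auto simp: signed_measure_empty)

lemma pos_var_cong: "(\<And>A. A \<in> sets borel \<Longrightarrow> \<nu> A = \<rho> A) \<Longrightarrow> pos_var \<nu> = pos_var \<rho>"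
  unfolding pos_var_def by (intro ext arg_cong[where f = Sup] Collect_cong) metis

text \<open>Passing from \<open>B\<close> to \<open>A - B\<close> exchanges the two suprema. This is
  the Jordan identity \<open>\<nu> = \<nu>\<^sup>+ - \<nu>\<^sup>-\<close>, obtained without
  choosing a Hahn set.\<close>

lemma pos_var_minus:
  assumes \<nu>: "signed_measure \<nu>" and A: "A \<in> sets borel"
  shows "pos_var (\<lambda>A. - \<nu> A) A = pos_var \<nu> A - \<nu> A"
proof (rule antisym)
  show "pos_var (\<lambda>A. - \<nu> A) A \<le> pos_var \<nu> A - \<nu> A"
  proof (rule pos_var_least)
    fix B assume B: "B \<in> sets borel" "B \<subseteq> A"
    have "\<nu> (A - B) \<le> pos_var \<nu> A" using A B by (intro pos_var_upper[OF \<nu>]) auto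
    then show "- \<nu> B \<le> pos_var \<nu> A - \<nu> A" using signed_measure_Diff[OF \<nu> A B] by simp
  qed
  have "pos_var \<nu> A \<le> pos_var (\<lambda>A. - \<nu> A) A + \<nu> A"
  proof (rule pos_var_least)
    fix B assume B: "B \<in> sets borel" "B \<subseteq> A"
    have "- \<nu> (A - B) \<le> pos_var (\<lambda>A. - \<nu> A) A"
      using A B pos_var_upper[OF signed_measure_minus[OF \<nu>], of "A - B" A] by auto
    then show "\<nu> B \<le> pos_var (\<lambda>A. - \<nu> A) A + \<nu> A" using signed_measure_Diff[OF \<nu> A B] by simp
  qed
  then show "pos_var \<nu> A - \<nu> A \<le> pos_var (\<lambda>A. - \<nu> A) A" by simp
qed

lemma pos_var_Un_ge:
  assumes \<nu>: "signed_measure \<nu>" and "A \<inter> B = {}"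
  shows "pos_var \<nu> A + pos_var \<nu> B \<le> pos_var \<nu> (A \<union> B)"
proof -
  have "pos_var \<nu> A \<le> pos_var \<nu> (A \<union> B) - pos_var \<nu> B"
  proof (rule pos_var_least)
    fix D assume D: "D \<in> sets borel" "D \<subseteq> A"
    have "pos_var \<nu> B \<le> pos_var \<nu> (A \<union> B) - \<nu> D"
    proof (rule pos_var_least)
      fix E assume E: "E \<in> sets borel" "E \<subseteq> B"
      have "\<nu> D + \<nu> E = \<nu> (D \<union> E)"
        using D E assms by (intro signed_measure_Un[symmetric]) auto
      also have "\<dots> \<le> pos_var \<nu> (A \<union> B)" using D E by (intro pos_var_upper[OF \<nu>]) auto
      finally show "\<nu> E \<le> pos_var \<nu> (A \<union> B) - \<nu> D" by simp
    qed
    then show "\<nu> D \<le> pos_var \<nu> (A \<union> B) - pos_var \<nu> B" by simp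
  qed
  then show ?thesis by simp
qed

lemma sum_pos_var_le:
  fixes A :: "nat \<Rightarrow> 'a::topological_space set"
  assumes \<nu>: "signed_measure \<nu>" and "disjoint_family_on A {..<n}"
  shows "(\<Sum>i<n. pos_var \<nu> (A i)) \<le> pos_var \<nu> (\<Union>i<n. A i)"
  using assms(2)
proof (induction n)
  case 0
  then show ?case by (simp add: pos_var_empty[OF \<nu>])
next
  case (Suc n)
  have "disjoint_family_on A {..<n}"
    using Suc.prems by (rule disjoint_family_on_mono[rotated]) auto
  then have "(\<Sum>i<Suc n. pos_var \<nu> (A i)) \<le> pos_var \<nu> (\<Union>i<n. A i) + pos_var \<nu> (A n)"
    using Suc.IH by simp
  also have "\<dots> \<le> pos_var \<nu> ((\<Union>i<n. A i) \<union> A n)"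
  proof (rule pos_var_Un_ge[OF \<nu>])
    have "A i \<inter> A n = {}" if "i < n" for i
      using disjoint_family_onD[OF Suc.prems, of i n] that by simp
    then show "(\<Union>i<n. A i) \<inter> A n = {}" by blast
  qed
  also have "(\<Union>i<n. A i) \<union> A n = (\<Union>i<Suc n. A i)" by (auto simp: lessThan_Suc)
  finally show ?case .
qed

text \<open>Superadditivity bounds the partial sums by the value on the union. Conversely, a Borel
  subset \<open>B\<close> of the union is cut into the pieces \<open>B \<inter> A n\<close>, each
  bounded by its own supremum.\<close>

lemma pos_var_sums:
  fixes A :: "nat \<Rightarrow> 'a::topological_space set"
  assumes \<nu>: "signed_measure \<nu>" and A: "\<And>n. A n \<in> sets borel" and disj: "disjoint_family A"
  shows "(\<lambda>n. pos_var \<nu> (A n)) sums pos_var \<nu> (\<Union>n. A n)"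
proof -
  have le: "(\<Sum>i<n. pos_var \<nu> (A i)) \<le> pos_var \<nu> (\<Union>n. A n)" for n
  proof -
    have "(\<Sum>i<n. pos_var \<nu> (A i)) \<le> pos_var \<nu> (\<Union>i<n. A i)"
      by (intro sum_pos_var_le[OF \<nu>] disjoint_family_on_mono[OF _ disj]) auto
    also have "\<dots> \<le> pos_var \<nu> (\<Union>n. A n)" by (intro pos_var_mono[OF \<nu>]) auto
    finally show ?thesis .
  qed
  have summ: "summable (\<lambda>n. pos_var \<nu> (A n))"
    by (intro summableI_nonneg_bounded[OF _ le] pos_var_nonneg[OF \<nu>])
  have "pos_var \<nu> (\<Union>n. A n) \<le> (\<Sum>n. pos_var \<nu> (A n))"
  proof (rule pos_var_least)
    fix B assume B: "B \<in> sets borel" "B \<subseteq> (\<Union>n. A n)"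
    have "(\<lambda>n. \<nu> (B \<inter> A n)) sums \<nu> (\<Union>n. B \<inter> A n)"
      using A B disj by (intro signed_measure_sums[OF \<nu>]) (auto intro: disjoint_family_subset)
    moreover have "(\<Union>n. B \<inter> A n) = B" using B by auto
    moreover have "\<nu> (B \<inter> A n) \<le> pos_var \<nu> (A n)" for n
      using A B by (intro pos_var_upper[OF \<nu>]) auto
    ultimately show "\<nu> B \<le> (\<Sum>n. pos_var \<nu> (A n))"
      using sums_le[of "\<lambda>n. \<nu> (B \<inter> A n)", OF _ _ summable_sums[OF summ]] by simp
  qed
  moreover have "(\<Sum>n. pos_var \<nu> (A n)) \<le> pos_var \<nu> (\<Union>n. A n)"
    using summ le by (rule suminf_le_const)
  ultimately show ?thesis using summ by (simp add: sums_iff)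
qed

section \<open>The positive variation as a finite Borel measure\<close>

lemma space_pos_var_measure [simp]: "space (pos_var_measure \<nu>) = UNIV"
  by (simp add: pos_var_measure_def space_measure_of_conv)

lemma sets_pos_var_measure [simp, measurable_cong]: "sets (pos_var_measure \<nu>) = sets borel"
  unfolding pos_var_measure_def
  by (subst sets_measure_of) (auto simp: sets.sigma_sets_eq[of borel, simplified])

text \<open>\<open>measure_of\<close> keeps the prescribed values only if they form a measure and
  gives the zero measure otherwise; \<open>pos_var_sums\<close> supplies the additivity.\<close>

lemma emeasure_pos_var_measure:
  assumes \<nu>: "signed_measure \<nu>" and "A \<in> sets borel"
  shows "emeasure (pos_var_measure \<nu>) A = ennreal (pos_var \<nu> A)"
proof (rule emeasure_measure_of[OF pos_var_measure_def])
  show "positive (sets (pos_var_measure \<nu>)) (\<lambda>A. ennreal (pos_var \<nu> A))"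
    by (simp add: positive_def pos_var_empty[OF \<nu>])
  show "countably_additive (sets (pos_var_measure \<nu>)) (\<lambda>A. ennreal (pos_var \<nu> A))"
  proof (rule countably_additiveI)
    fix A :: "nat \<Rightarrow> _" assume "range A \<subseteq> sets (pos_var_measure \<nu>)" "disjoint_family A"
    then have "(\<lambda>n. pos_var \<nu> (A n)) sums pos_var \<nu> (\<Union>n. A n)"
      by (intro pos_var_sums[OF \<nu>]) auto
    then show "(\<Sum>i. ennreal (pos_var \<nu> (A i))) = ennreal (pos_var \<nu> (\<Union> (range A)))"
      by (subst suminf_ennreal2) (auto simp: sums_iff pos_var_nonneg[OF \<nu>])
  qed
qed (use assms in auto)

lemma measure_pos_var_measure:
  "signed_measure \<nu> \<Longrightarrow> A \<in> sets borel \<Longrightarrow> measure (pos_var_measure \<nu>) A = pos_var \<nu> A"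
  by (simp add: measure_def emeasure_pos_var_measure pos_var_nonneg)

lemma finite_measure_pos_var_measure:
  "signed_measure \<nu> \<Longrightarrow> finite_measure (pos_var_measure \<nu>)"
  by (intro finite_measureI) (simp add: emeasure_pos_var_measure)

lemma pos_var_measure_cong:
  assumes "\<And>A. A \<in> sets borel \<Longrightarrow> \<nu> A = \<rho> A"
  shows "pos_var_measure \<nu> = pos_var_measure \<rho>"
  using pos_var_cong[of \<nu> \<rho>, OF assms] by (simp add: pos_var_measure_def)

lemma signed_integral_cong_measure:
  assumes "\<And>A. A \<in> sets borel \<Longrightarrow> \<nu> A = \<rho> A"
  shows "signed_integral \<nu> f = signed_integral \<rho> f"
proof -
  have "pos_var_measure \<nu> = pos_var_measure \<rho>"
    "pos_var_measure (\<lambda>A. - \<nu> A) = pos_var_measure (\<lambda>A. - \<rho> A)"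
    by (intro pos_var_measure_cong; simp add: assms)+
  then show ?thesis by (simp add: signed_integral_def)
qed

lemma pos_var_of_nonneg:
  assumes "signed_measure \<nu>" "\<And>A. A \<in> sets borel \<Longrightarrow> 0 \<le> \<nu> A" "A \<in> sets borel"
  shows "pos_var \<nu> A = \<nu> A"
proof (rule antisym)
  show "pos_var \<nu> A \<le> \<nu> A"
  proof (rule pos_var_least)
    fix B assume B: "B \<in> sets borel" "B \<subseteq> A"
    show "\<nu> B \<le> \<nu> A"
      using signed_measure_Diff[OF assms(1,3) B] assms(2)[of "A - B"] assms(3) B by auto
  qed
qed (use assms in \<open>auto intro: pos_var_upper\<close>)

text \<open>Here \<open>\<nu>\<^sup>-\<close> has total mass 0, so its integral vanishes and a
  single ordinary integral remains.\<close>

lemma signed_integral_of_nonneg: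
  assumes "signed_measure \<nu>" "\<And>A. A \<in> sets borel \<Longrightarrow> 0 \<le> \<nu> A"
  shows "signed_integral \<nu> f = (\<integral>x. f x \<partial>pos_var_measure \<nu>)"
proof -
  have "pos_var (\<lambda>A. - \<nu> A) UNIV = 0"
    using assms by (simp add: pos_var_minus pos_var_of_nonneg)
  then have "emeasure (pos_var_measure (\<lambda>A. - \<nu> A)) (space (pos_var_measure (\<lambda>A. - \<nu> A))) = 0"
    using assms by (simp add: emeasure_pos_var_measure signed_measure_minus)
  then have "AE x in pos_var_measure (\<lambda>A. - \<nu> A). f x = 0"
    by (intro AE_I[of _ _ "space (pos_var_measure (\<lambda>A. - \<nu> A))"]) auto
  then show ?thesis by (simp add: signed_integral_def integral_eq_zero_AE)
qed

lemma integrable_pos_var_measure: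
  fixes f :: "'a::topological_space \<Rightarrow> real"
  assumes "signed_measure \<nu>" "f \<in> borel_measurable borel" "\<And>x. \<bar>f x\<bar> \<le> c"
  shows "integrable (pos_var_measure \<nu>) f"
  using assms
  by (intro finite_measure.integrable_const_bound[where B = c] finite_measure_pos_var_measure) auto

section \<open>Integration against signed measures\<close>

lemma signed_integral_indicator:
  assumes "signed_measure \<nu>" "A \<in> sets borel"
  shows "signed_integral \<nu> (indicator A) = \<nu> A"
  using assms
  by (simp add: signed_integral_def measure_pos_var_measure signed_measure_minus pos_var_minus)

lemma signed_integral_add:
  assumes "signed_measure \<nu>" "f \<in> borel_measurable borel" "\<And>x. \<bar>f x\<bar> \<le> c"
    and "g \<in> borel_measurable borel" "\<And>x. \<bar>g x\<bar> \<le> d"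
  shows "signed_integral \<nu> (\<lambda>x. f x + g x) = signed_integral \<nu> f + signed_integral \<nu> g"
  using integrable_pos_var_measure[OF assms(1-3)] integrable_pos_var_measure[OF assms(1,4,5)]
    integrable_pos_var_measure[OF signed_measure_minus[OF assms(1)] assms(2,3)]
    integrable_pos_var_measure[OF signed_measure_minus[OF assms(1)] assms(4,5)]
  by (simp add: signed_integral_def)

lemma signed_integral_cmult: "signed_integral \<nu> (\<lambda>x. c * f x) = c * signed_integral \<nu> f"
  by (simp add: signed_integral_def right_diff_distrib)

lemma signed_integral_tendsto:
  fixes f :: "nat \<Rightarrow> 'a::topological_space \<Rightarrow> real"
  assumes "signed_measure \<nu>" "\<And>i. f i \<in> borel_measurable borel" "\<And>i x. \<bar>f i x\<bar> \<le> c"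
    and "\<And>x. (\<lambda>i. f i x) \<longlonglongrightarrow> g x" "g \<in> borel_measurable borel"
  shows "(\<lambda>i. signed_integral \<nu> (f i)) \<longlonglongrightarrow> signed_integral \<nu> g"
  unfolding signed_integral_def
proof (rule tendsto_diff)
  have "(\<lambda>i. \<integral>x. f i x \<partial>pos_var_measure \<rho>) \<longlonglongrightarrow> (\<integral>x. g x \<partial>pos_var_measure \<rho>)"
    if "signed_measure \<rho>" for \<rho>
    using assms that
    by (intro integral_dominated_convergence[where w = "\<lambda>_. c"]
        integrable_pos_var_measure[where c = "\<bar>c\<bar>"]) auto
  then show "(\<lambda>i. \<integral>x. f i x \<partial>pos_var_measure \<nu>) \<longlonglongrightarrow> (\<integral>x. g x \<partial>pos_var_measure \<nu>)"
    "(\<lambda>i. \<integral>x. f i x \<partial>pos_var_measure (\<lambda>A. - \<nu> A))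
      \<longlonglongrightarrow> (\<integral>x. g x \<partial>pos_var_measure (\<lambda>A. - \<nu> A))"
    using assms(1) signed_measure_minus by blast+
qed

text \<open>The Jordan parts of a combination are not the combinations of the Jordan parts, so
  linearity in the measure is not immediate. On indicators both sides are values at a set; the rest
  is induction on nonnegative measurable functions, with the bound carried along as a
  premise.\<close>

lemma signed_integral_lincomb:
  assumes \<nu>: "signed_measure \<nu>" and \<rho>: "signed_measure \<rho>"
    and f: "f \<in> borel_measurable borel" "\<And>x. 0 \<le> f x" "\<exists>c. \<forall>x. f x \<le> c"
  shows "signed_integral (\<lambda>A. a * \<nu> A + b * \<rho> A) f = a * signed_integral \<nu> f + b * signed_integral \<rho> f"
  using f
proof (induction rule: borel_measurable_induct_real)
  case (set A)
  then show ?case by (simp add: signed_integral_indicator signed_measure_lincomb \<nu> \<rho>)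
next
  case (mult f c)
  show ?case
  \<comment> \<open>A bound on \<open>c * f\<close> yields one on \<open>f\<close> only when
    \<open>c\<close> is nonzero.\<close>
  proof (cases "c = 0")
    case True
    then show ?thesis by (simp add: signed_integral_def)
  next
    case False
    obtain d where "\<And>x. c * f x \<le> d" using mult.prems by blast
    then have "\<exists>d. \<forall>x. f x \<le> d"
      using False mult.hyps(1) by (intro exI[of _ "d / c"]) (simp add: field_simps)
    then show ?thesis
      using mult.IH by (simp add: signed_integral_cmult algebra_simps)
  qed
next
  case (add f g)
  obtain c where c: "\<And>x. g x + f x \<le> c" using add.prems by blast
  have "f x \<le> c" "g x \<le> c" for x
    using c[of x] add.hyps(2)[of x] add.hyps(4)[of x] by linarith+
  then have bd: "\<bar>f x\<bar> \<le> c" "\<bar>g x\<bar> \<le> c" for x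
    using add.hyps by (simp_all add: abs_of_nonneg)
  have sum: "signed_integral \<tau> (\<lambda>x. g x + f x) = signed_integral \<tau> g + signed_integral \<tau> f"
    if "signed_measure \<tau>" for \<tau>
    using that add.hyps bd by (intro signed_integral_add[where c = c and d = c]) auto
  have "\<exists>c. \<forall>x. f x \<le> c" "\<exists>c. \<forall>x. g x \<le> c" using bd by (meson abs_le_D1)+
  then show ?case
    using add.IH
    unfolding sum[OF \<nu>] sum[OF \<rho>] sum[OF signed_measure_lincomb[OF \<nu> \<rho>]]
    by (simp add: algebra_simps)
next
  case (seq U)
  obtain c where c: "\<And>x. f x \<le> c" using seq.prems by blast
  have "U i x \<le> f x" for i x
    using seq.hyps(3,4) by (intro incseq_le[of "\<lambda>i. U i x"]) (simp_all add: incseq_def le_fun_def)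
  then have Uc: "U i x \<le> c" for i x by (rule order_trans[OF _ c])
  then have Uabs: "\<bar>U i x\<bar> \<le> c" for i x using seq.hyps(2) by simp
  have lim: "(\<lambda>i. signed_integral \<tau> (U i)) \<longlonglongrightarrow> signed_integral \<tau> f" if "signed_measure \<tau>" for \<tau>
    using seq.hyps(4) by (intro signed_integral_tendsto[OF that seq.hyps(1) Uabs _ f(1)]) simp
  have "signed_integral (\<lambda>A. a * \<nu> A + b * \<rho> A) (U i)
      = a * signed_integral \<nu> (U i) + b * signed_integral \<rho> (U i)" for i
    using seq.IH Uc by blast
  then have "(\<lambda>i. signed_integral (\<lambda>A. a * \<nu> A + b * \<rho> A) (U i))
      \<longlonglongrightarrow> a * signed_integral \<nu> f + b * signed_integral \<rho> f"
    by (auto intro!: tendsto_intros lim \<nu> \<rho>)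
  then show ?case
    using lim[OF signed_measure_lincomb[OF \<nu> \<rho>]] LIMSEQ_unique by blast
qed

section \<open>Probability measures and point masses\<close>

lemma prob_signed_measureD:
  assumes "prob_signed_measure \<nu>"
  shows "signed_measure \<nu>" "\<And>A. A \<in> sets borel \<Longrightarrow> 0 \<le> \<nu> A" "\<nu> UNIV = 1"
    "\<And>A. A \<in> sets borel \<Longrightarrow> \<nu> A \<le> 1"
proof -
  show *: "signed_measure \<nu>" "\<And>A. A \<in> sets borel \<Longrightarrow> 0 \<le> \<nu> A" "\<nu> UNIV = 1"
    using assms by (auto simp: prob_signed_measure_def)
  fix A :: "'a set" assume A: "A \<in> sets borel"
  then show "\<nu> A \<le> 1"
    using pos_var_upper[OF *(1), of A UNIV] pos_var_of_nonneg[OF *(1,2), of UNIV] *(3) by simp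
qed

lemma measure_prob_signed_measure:
  "prob_signed_measure \<nu> \<Longrightarrow> A \<in> sets borel \<Longrightarrow> measure (pos_var_measure \<nu>) A = \<nu> A"
  by (simp add: measure_pos_var_measure pos_var_of_nonneg prob_signed_measureD)

lemma signed_measure_dirac: "signed_measure (\<lambda>A. indicator A x)"
  unfolding signed_measure_def by (auto intro!: indicator_sums dest: disjoint_family_onD)

lemma prob_signed_measure_dirac: "prob_signed_measure (\<lambda>A. indicator A x)"
  by (simp add: prob_signed_measure_def signed_measure_dirac)

lemma signed_integral_dirac:
  fixes f :: "'a::topological_space \<Rightarrow> real"
  assumes [measurable]: "f \<in> borel_measurable borel"
  shows "signed_integral (\<lambda>A. indicator A x) f = f x"
proof -
  let ?M = "pos_var_measure (\<lambda>A. indicator A x :: real)"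
  have m: "measure ?M A = indicator A x" if "A \<in> sets borel" for A
    using measure_prob_signed_measure[OF prob_signed_measure_dirac that] by simp
  interpret finite_measure ?M
    by (rule finite_measure_pos_var_measure[OF signed_measure_dirac])
  \<comment> \<open>Singletons need not be Borel in a general topological space; this set is Borel
    and misses \<open>x\<close>, so it is null for the point mass.\<close>
  have "{y. f y \<noteq> f x} \<in> sets borel" by measurable
  then have "AE y in ?M. f y = f x"
    using m[of "{y. f y \<noteq> f x}"]
    by (intro AE_I[of _ _ "{y. f y \<noteq> f x}"]) (auto simp: emeasure_eq_measure)
  then have "(\<integral>y. f y \<partial>?M) = (\<integral>y. f x \<partial>?M)" by (intro integral_cong_AE) auto
  also have "\<dots> = f x" using m[of UNIV] by simp
  finally show ?thesis
    by (subst signed_integral_of_nonneg) (auto simp: signed_measure_dirac)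
qed

section \<open>Markov kernels\<close>

text \<open>Total mass 0 makes \<open>\<nu>\<^sup>+\<close> and \<open>\<nu>\<^sup>-\<close> equally
  heavy, hence the factor 2; from here on convergence is measured by
  \<open>pos_var \<nu> UNIV\<close>. The last bound comes from families consisting of one set and
  serves the uniqueness of the invariant measure.\<close>

lemma tv_norm_bounds:
  fixes \<nu> :: "'a::topological_space set \<Rightarrow> real"
  assumes \<nu>: "signed_measure \<nu>" and "\<nu> UNIV = 0"
  shows "0 \<le> tv_norm \<nu>" "tv_norm \<nu> \<le> 2 * pos_var \<nu> UNIV"
    "\<And>A. A \<in> sets borel \<Longrightarrow> \<bar>\<nu> A\<bar> \<le> tv_norm \<nu>"
proof -
  let ?S = "{(\<Sum>i<n. \<bar>\<nu> (A i)\<bar>) | (n::nat) A.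
       (\<forall>i<n. A i \<in> sets borel) \<and> disjoint_family_on A {..<n}}"
  let ?\<nu>' = "\<lambda>A. - \<nu> A"
  have le: "r \<le> 2 * pos_var \<nu> UNIV" if r: "r \<in> ?S" for r
  proof -
    obtain n :: nat and A where A: "r = (\<Sum>i<n. \<bar>\<nu> (A i)\<bar>)" "\<And>i. i < n \<Longrightarrow> A i \<in> sets borel"
      "disjoint_family_on A {..<n}"
      using r by blast
    have "\<bar>\<nu> (A i)\<bar> \<le> pos_var \<nu> (A i) + pos_var ?\<nu>' (A i)" if "i < n" for i
      using pos_var_upper[OF \<nu> A(2)[OF that] order_refl] pos_var_nonneg[OF \<nu>, of "A i"]
        pos_var_minus[OF \<nu> A(2)[OF that]] pos_var_nonneg[OF signed_measure_minus[OF \<nu>], of "A i"]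
      by linarith
    then have "r \<le> (\<Sum>i<n. pos_var \<nu> (A i) + pos_var ?\<nu>' (A i))"
      unfolding A(1) by (intro sum_mono) simp
    also have "\<dots> = (\<Sum>i<n. pos_var \<nu> (A i)) + (\<Sum>i<n. pos_var ?\<nu>' (A i))"
      by (rule sum.distrib)
    also have "\<dots> \<le> pos_var \<nu> UNIV + pos_var ?\<nu>' UNIV"
      using \<nu> signed_measure_minus[OF \<nu>] A(3)
      by (intro add_mono order_trans[OF sum_pos_var_le pos_var_mono]) auto
    also have "\<dots> = 2 * pos_var \<nu> UNIV"
      using assms by (simp add: pos_var_minus)
    finally show ?thesis .
  qed
  have mem: "\<bar>\<nu> A\<bar> \<in> ?S" if "A \<in> sets borel" for A
    using that
    by (intro CollectI exI[of _ "1::nat"] exI[of _ "\<lambda>_. A"]) (auto simp: disjoint_family_on_def)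
  have "bdd_above ?S" using le by (rule bdd_aboveI)
  then show upper: "\<bar>\<nu> A\<bar> \<le> tv_norm \<nu>" if "A \<in> sets borel" for A
    unfolding tv_norm_def using mem[OF that] by (intro cSup_upper)
  show "0 \<le> tv_norm \<nu>" using upper[of "{}"] by simp
  have "?S \<noteq> {}" using mem[of "{}"] by blast
  then show "tv_norm \<nu> \<le> 2 * pos_var \<nu> UNIV"
    unfolding tv_norm_def using le by (intro cSup_least)
qed

section \<open>Markov operators: linearity, positivity, contraction\<close>

locale markov_kernel =
  fixes p :: "'a::topological_space \<Rightarrow> 'a set \<Rightarrow> real"
  assumes prob: "prob_signed_measure (p x)"
    and measurable_kernel [measurable]: "A \<in> sets borel \<Longrightarrow> (\<lambda>x. p x A) \<in> borel_measurable borel"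
begin

lemmas p_signed = prob_signed_measureD(1)[OF prob]
lemmas p_nonneg = prob_signed_measureD(2)[OF prob]
lemmas p_UNIV = prob_signed_measureD(3)[OF prob]
lemmas p_le_1 = prob_signed_measureD(4)[OF prob]

lemma p_abs_le_1: "A \<in> sets borel \<Longrightarrow> \<bar>p x A\<bar> \<le> 1"
  using p_nonneg p_le_1 by simp

lemma integrable_p:
  "signed_measure \<nu> \<Longrightarrow> A \<in> sets borel \<Longrightarrow> integrable (pos_var_measure \<nu>) (\<lambda>x. p x A)"
  by (rule integrable_pos_var_measure[where c = 1]) (auto simp: p_abs_le_1)

lemma kernel_op_lincomb:
  assumes "signed_measure \<nu>" "signed_measure \<rho>" "A \<in> sets borel"
  shows "kernel_op p (\<lambda>A. a * \<nu> A + b * \<rho> A) A = a * kernel_op p \<nu> A + b * kernel_op p \<rho> A"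
  unfolding kernel_op_def using assms
  by (intro signed_integral_lincomb) (auto intro: p_nonneg p_le_1)

lemma kernel_op_diff:
  assumes "signed_measure \<nu>" "signed_measure \<rho>" "A \<in> sets borel"
  shows "kernel_op p (\<lambda>A. \<nu> A - c * \<rho> A) A = kernel_op p \<nu> A - c * kernel_op p \<rho> A"
  using kernel_op_lincomb[OF assms, of 1 "- c"] by simp

lemma kernel_op_UNIV: "signed_measure \<nu> \<Longrightarrow> kernel_op p \<nu> UNIV = \<nu> UNIV"
  using signed_integral_indicator[of \<nu> UNIV]
  by (simp add: kernel_op_def p_UNIV indicator_def)

text \<open>Countable additivity is dominated convergence for the partial sums of
  \<open>p x (A i)\<close>, which lie between 0 and 1 because the \<open>A i\<close> are disjoint
  and \<open>p x\<close> is a probability measure.\<close>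

lemma signed_measure_kernel_op:
  assumes \<nu>: "signed_measure \<nu>"
  shows "signed_measure (kernel_op p \<nu>)"
  unfolding signed_measure_def
proof (intro conjI allI impI)
  show "kernel_op p \<nu> {} = 0"
    by (simp add: kernel_op_def signed_measure_empty[OF p_signed] signed_integral_def)
  fix A :: "nat \<Rightarrow> 'a set" assume "range A \<subseteq> sets borel" and disj: "disjoint_family A"
  then have A [measurable]: "A i \<in> sets borel" for i by auto
  have sums: "(\<lambda>i. p x (A i)) sums p x (\<Union>i. A i)" for x
    using A disj by (intro signed_measure_sums[OF p_signed])
  have bound: "\<bar>\<Sum>i<n. p x (A i)\<bar> \<le> 1" for n x
  proof -
    have "(\<Sum>i<n. p x (A i)) \<le> p x (\<Union>i. A i)"
      using sums[of x] p_nonneg[OF A] by (metis sum_le_suminf finite_lessThan sums_iff)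
    also have "\<dots> \<le> 1" by (intro p_le_1) measurable
    finally show ?thesis by (simp add: sum_nonneg p_nonneg)
  qed
  have "signed_integral \<nu> (\<lambda>x. \<Sum>i<n. p x (A i)) = (\<Sum>i<n. kernel_op p \<nu> (A i))" for n
  proof (induction n)
    case 0
    then show ?case by (simp add: signed_integral_def)
  next
    case (Suc n)
    have "signed_integral \<nu> (\<lambda>x. (\<Sum>i<n. p x (A i)) + p x (A n))
        = signed_integral \<nu> (\<lambda>x. \<Sum>i<n. p x (A i)) + signed_integral \<nu> (\<lambda>x. p x (A n))"
      by (rule signed_integral_add[OF \<nu>, where c = 1 and d = 1]) (auto simp: bound p_abs_le_1)
    then show ?case using Suc by (simp add: kernel_op_def)
  qed
  moreover have "(\<lambda>n. signed_integral \<nu> (\<lambda>x. \<Sum>i<n. p x (A i))) \<longlonglongrightarrow> kernel_op p \<nu> (\<Union>i. A i)"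
    unfolding kernel_op_def using sums
    by (intro signed_integral_tendsto[OF \<nu>, where c = 1]) (auto simp: bound sums_def)
  ultimately show "(\<lambda>i. kernel_op p \<nu> (A i)) sums kernel_op p \<nu> (\<Union>i. A i)"
    by (simp add: sums_def)
qed

lemma kernel_op_nonneg:
  assumes "signed_measure \<nu>" "\<And>A. A \<in> sets borel \<Longrightarrow> 0 \<le> \<nu> A" "A \<in> sets borel"
  shows "0 \<le> kernel_op p \<nu> A"
  using assms by (simp add: kernel_op_def signed_integral_of_nonneg p_nonneg)

lemma kernel_op_le_pos_part:
  assumes "signed_measure \<nu>" "A \<in> sets borel"
  shows "kernel_op p \<nu> A \<le> (\<integral>x. p x A \<partial>pos_var_measure \<nu>)"
  using assms by (simp add: kernel_op_def signed_integral_def p_nonneg)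

lemma integral_p_le:
  assumes \<nu>: "signed_measure \<nu>" and "A \<in> sets borel"
  shows "(\<integral>x. p x A \<partial>pos_var_measure \<nu>) \<le> pos_var \<nu> UNIV"
proof -
  interpret finite_measure "pos_var_measure \<nu>"
    by (rule finite_measure_pos_var_measure[OF \<nu>])
  have "(\<integral>x. p x A \<partial>pos_var_measure \<nu>) \<le> (\<integral>x. 1 \<partial>pos_var_measure \<nu>)"
    using assms by (intro integral_mono integrable_p) (auto simp: p_le_1)
  also have "\<dots> = pos_var \<nu> UNIV" using measure_pos_var_measure[OF \<nu>, of UNIV] by simp
  finally show ?thesis .
qed

text \<open>Contraction: the contribution of \<open>\<nu>\<^sup>-\<close> only lowers the value, and
  \<open>p x A\<close> is at most 1 under \<open>\<nu>\<^sup>+\<close>.\<close>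

lemma pos_var_kernel_op_le:
  assumes "signed_measure \<nu>"
  shows "pos_var (kernel_op p \<nu>) UNIV \<le> pos_var \<nu> UNIV"
  using assms
  by (intro pos_var_least order_trans[OF kernel_op_le_pos_part integral_p_le]) auto

text \<open>Recovers the kernel from the operator, so that the semigroup law for operators can be
  read as one for transition probabilities.\<close>

lemma kernel_op_dirac: "A \<in> sets borel \<Longrightarrow> kernel_op p (\<lambda>A. indicator A x) A = p x A"
  by (simp add: kernel_op_def signed_integral_dirac)

end

section \<open>Regular kernels\<close>

text \<open>Markov's inequality: the bracket is the mass of \<open>{x. \<delta> < f x}\<close> under
  \<open>\<rho>\<^sup>+\<close>. It is written through the complement because that is the set whose
  mass will be known to be small.\<close>

lemma integral_pos_var_measure_ge:
  fixes f :: "'a::topological_space \<Rightarrow> real"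
  assumes \<rho>: "signed_measure \<rho>" and f [measurable]: "f \<in> borel_measurable borel"
    and bounds: "\<And>x. 0 \<le> f x" "\<And>x. f x \<le> 1"
  shows "\<delta> * (pos_var \<rho> UNIV - pos_var \<rho> {x. f x \<le> \<delta>}) \<le> (\<integral>x. f x \<partial>pos_var_measure \<rho>)"
proof -
  let ?M = "pos_var_measure \<rho>"
  interpret finite_measure ?M by (rule finite_measure_pos_var_measure[OF \<rho>])
  have S: "{x. f x \<le> \<delta>} \<in> sets borel" "{x. \<delta> < f x} \<in> sets borel" by measurable
  have "measure ?M (space ?M - {x. f x \<le> \<delta>}) = measure ?M (space ?M) - measure ?M {x. f x \<le> \<delta>}"
    using S by (intro finite_measure_compl) simp
  moreover have "space ?M - {x. f x \<le> \<delta>} = {x. \<delta> < f x}" by auto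
  ultimately have "pos_var \<rho> UNIV - pos_var \<rho> {x. f x \<le> \<delta>} = measure ?M {x. \<delta> < f x}"
    using measure_pos_var_measure[OF \<rho> S(1)] measure_pos_var_measure[OF \<rho>, of UNIV] by simp
  then have "\<delta> * (pos_var \<rho> UNIV - pos_var \<rho> {x. f x \<le> \<delta>})
      = (\<integral>x. \<delta> * indicator {x. \<delta> < f x} x \<partial>?M)"
    by simp
  also have "\<dots> \<le> (\<integral>x. f x \<partial>?M)"
  proof (rule integral_mono)
    show "integrable ?M f"
      using bounds by (intro integrable_pos_var_measure[OF \<rho>, of _ 1]) auto
    show "integrable ?M (\<lambda>x. \<delta> * indicator {x. \<delta> < f x} x)"
      by (intro integrable_pos_var_measure[OF \<rho>, of _ "\<bar>\<delta>\<bar>"]) (auto simp: indicator_def)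
    show "\<delta> * indicator {x. \<delta> < f x} x \<le> f x" for x
      using bounds(1)[of x] by (simp add: indicator_def)
  qed
  finally show ?thesis .
qed

locale regular_kernel = markov_kernel +
  assumes reg: "equivalent_measures (p x) (p y)"
begin

lemma p_eq_0_iff: "A \<in> sets borel \<Longrightarrow> p x A = 0 \<longleftrightarrow> p y A = 0"
  using reg[of x y] by (simp add: equivalent_measures_def)

text \<open>By regularity \<open>p y A\<close> is zero for every \<open>y\<close> or positive for
  every \<open>y\<close>, and a positive function has a positive integral against a probability
  measure. All images of probability measures thus share their null sets with every
  \<open>p x\<close>.\<close>

lemma kernel_op_eq_0_iff:
  assumes \<nu>: "prob_signed_measure \<nu>" and A: "A \<in> sets borel"
  shows "kernel_op p \<nu> A = 0 \<longleftrightarrow> p x A = 0"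
proof
  assume "p x A = 0"
  then have "p y A = 0" for y using p_eq_0_iff[OF A] by blast
  then show "kernel_op p \<nu> A = 0" by (simp add: kernel_op_def signed_integral_def)
next
  let ?M = "pos_var_measure \<nu>"
  note \<nu>D = prob_signed_measureD[OF \<nu>]
  interpret finite_measure ?M by (rule finite_measure_pos_var_measure[OF \<nu>D(1)])
  assume "kernel_op p \<nu> A = 0"
  then have "(\<integral>y. p y A \<partial>?M) = 0" by (simp add: kernel_op_def signed_integral_of_nonneg[OF \<nu>D(1,2)])
  then have "AE y in ?M. p y A = 0"
    using \<nu>D A by (subst (asm) integral_nonneg_eq_0_iff_AE) (auto simp: p_nonneg integrable_p)
  show "p x A = 0"
  proof (rule ccontr)
    assume "p x A \<noteq> 0"
    then have "p y A \<noteq> 0" for y using p_eq_0_iff[OF A] by blast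
    with \<open>AE y in ?M. p y A = 0\<close> have "AE y in ?M. False" by simp
    then have "measure ?M (space ?M) = 0" by (simp add: AE_iff_measurable[OF sets.top] emeasure_eq_measure)
    then show False using measure_prob_signed_measure[OF \<nu>, of UNIV] \<nu>D(3) by simp
  qed
qed

text \<open>If sets \<open>A n\<close> were almost null for many starting points and almost full for many others, with
  error \<open>2\<^sup>-\<^sup>n\<close>, then a single pair \<open>(x, y)\<close> would see both behaviours for infinitely many \<open>n\<close>, because
  the product sets in question have measure bounded below. Along these \<open>n\<close> the limes superior of \<open>A n\<close>
  is null for \<open>p x\<close> by Borel-Cantelli and has full measure for \<open>p y\<close>, contradicting regularity.\<close>
lemma no_uniformly_separating_sets:
  assumes \<mu>: "prob_signed_measure \<mu>" and "0 < c"
  shows "\<exists>\<delta>>0. \<forall>A\<in>sets borel. \<mu> {x. p x A \<le> \<delta>} < c \<or> \<mu> {x. 1 - \<delta> \<le> p x A} < c"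
proof (rule ccontr)
  assume "\<not> ?thesis"
  then have "\<forall>\<delta>>0. \<exists>A\<in>sets borel. c \<le> \<mu> {x. p x A \<le> \<delta>} \<and> c \<le> \<mu> {x. 1 - \<delta> \<le> p x A}"
    by (meson not_le)
  then have "\<exists>A\<in>sets borel. c \<le> \<mu> {x. p x A \<le> (1/2) ^ n} \<and> c \<le> \<mu> {x. 1 - (1/2) ^ n \<le> p x A}"
    for n :: nat by simp
  then obtain A where A [measurable]: "\<And>n::nat. A n \<in> sets borel"
    and c_le: "\<And>n. c \<le> \<mu> {x. p x (A n) \<le> (1/2) ^ n}" "\<And>n. c \<le> \<mu> {x. 1 - (1/2) ^ n \<le> p x (A n)}"
    by metis
  define E where "E n = {x. p x (A n) \<le> (1/2) ^ n}" for n
  define F where "F n = {x. 1 - (1/2) ^ n \<le> p x (A n)}" for n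
  let ?M = "pos_var_measure \<mu>"
  let ?N = "?M \<Otimes>\<^sub>M ?M"
  have EF [measurable]: "E n \<in> sets borel" "F n \<in> sets borel" for n
    unfolding E_def F_def by measurable
  interpret M: finite_measure ?M
    by (rule finite_measure_pos_var_measure[OF prob_signed_measureD(1)[OF \<mu>]])
  interpret N: finite_measure ?N
    by (rule finite_measure_pair_measure[OF M.finite_measure_axioms M.finite_measure_axioms])
  have N_EF: "c * c \<le> measure ?N (E n \<times> F n)" for n
  proof -
    have "emeasure ?N (E n \<times> F n) = emeasure ?M (E n) * emeasure ?M (F n)"
      by (intro M.emeasure_pair_measure_Times) auto
    then have "measure ?N (E n \<times> F n) = measure ?M (E n) * measure ?M (F n)"
      by (simp add: measure_def enn2real_mult)
    also have "\<dots> = \<mu> (E n) * \<mu> (F n)"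
      by (simp add: measure_prob_signed_measure[OF \<mu>])
    finally show ?thesis
      using c_le[of n] \<open>0 < c\<close> by (simp add: E_def F_def mult_mono)
  qed
  \<comment> \<open>The intersection of the \<open>G n\<close> is the limes superior of the product
    sets. Continuity from above bounds its measure below by \<open>c * c\<close>, so it contains a
    point.\<close>
  define G where "G n = (\<Union>m\<in>{n..}. E m \<times> F m)" for n
  have G [measurable]: "G n \<in> sets ?N" for n
    unfolding G_def by (intro sets.countable_UN') auto
  have "decseq G" unfolding decseq_def G_def by (intro allI impI UN_mono) auto
  then have "(\<lambda>n. measure ?N (G n)) \<longlonglongrightarrow> measure ?N (\<Inter>n. G n)"
    by (intro N.finite_Lim_measure_decseq image_subsetI G)
  moreover have "c * c \<le> measure ?N (G n)" for n
    using N_EF[of n] by (rule order_trans) (auto intro!: N.finite_measure_mono simp: G_def)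
  ultimately have "c * c \<le> measure ?N (\<Inter>n. G n)" by (intro LIMSEQ_le_const) auto
  then have "(\<Inter>n. G n) \<noteq> {}" using \<open>0 < c\<close> by (auto simp: mult_le_0_iff)
  then obtain x y where xy: "\<And>n. (x, y) \<in> G n" by auto
  \<comment> \<open>Putting the empty set at the remaining indices replaces the choice of a
    subsequence and keeps the Borel-Cantelli sum below the geometric series.\<close>
  define B where "B n = (if x \<in> E n \<and> y \<in> F n then A n else {})" for n
  have B [measurable]: "B n \<in> sets borel" for n by (simp add: B_def)
  define C where "C n = (\<Union>m\<in>{n..}. B m)" for n
  have C [measurable]: "C n \<in> sets borel" for n
    unfolding C_def by (intro sets.countable_UN') auto
  have C': "(\<Inter>n. C n) \<in> sets borel" by measurable
  let ?X = "pos_var_measure (p x)" and ?Y = "pos_var_measure (p y)"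
  interpret X: finite_measure ?X by (rule finite_measure_pos_var_measure[OF p_signed])
  interpret Y: finite_measure ?Y by (rule finite_measure_pos_var_measure[OF p_signed])
  have "AE z in ?X. eventually (\<lambda>n. z \<in> space ?X - B n) sequentially"
  proof (rule borel_cantelli_AE1)
    have "measure ?X (B n) \<le> (1/2) ^ n" for n
      by (auto simp: B_def E_def measure_prob_signed_measure[OF prob] signed_measure_empty[OF p_signed])
    then show "summable (\<lambda>n. measure ?X (B n))"
      by (intro summable_comparison_test'[OF summable_geometric[of "1/2::real"]]) auto
  qed (auto simp: X.emeasure_eq_measure)
  then have "AE z in ?X. z \<notin> (\<Inter>n. C n)"
    by eventually_elim (auto simp: eventually_sequentially C_def)
  then have "measure ?X (\<Inter>n. C n) = 0"
    using C' by (subst (asm) AE_iff_measurable[where N = "\<Inter>n. C n"]) (auto simp: measure_def)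
  then have "p x (\<Inter>n. C n) = 0" using C' by (simp add: measure_prob_signed_measure[OF prob])
  moreover have "1 \<le> p y (\<Inter>n. C n)"
  proof -
    have "1 - (1/2) ^ n \<le> measure ?Y (C n)" for n
    proof -
      obtain m where m: "n \<le> m" "x \<in> E m" "y \<in> F m" using xy[of n] by (auto simp: G_def)
      have "1 - (1/2) ^ n \<le> (1::real) - (1/2) ^ m" using m(1) by (simp add: power_decreasing)
      also have "\<dots> \<le> measure ?Y (B m)"
        using m by (simp add: B_def F_def measure_prob_signed_measure[OF prob])
      also have "\<dots> \<le> measure ?Y (C n)"
        using m(1) by (intro Y.finite_measure_mono) (auto simp: C_def)
      finally show ?thesis .
    qed
    moreover have "decseq C" unfolding decseq_def C_def by (intro allI impI UN_mono) auto
    then have "(\<lambda>n. measure ?Y (C n)) \<longlonglongrightarrow> measure ?Y (\<Inter>n. C n)"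
      by (intro Y.finite_Lim_measure_decseq) auto
    moreover have "(\<lambda>n. 1 - (1/2) ^ n) \<longlonglongrightarrow> (1 - 0 :: real)"
      by (intro tendsto_intros LIMSEQ_power_zero) simp
    ultimately have "1 - 0 \<le> measure ?Y (\<Inter>n. C n)" by (intro LIMSEQ_le) auto
    then show ?thesis using C' by (simp add: measure_prob_signed_measure[OF prob])
  qed
  ultimately show False using p_eq_0_iff[OF C', of x y] by simp
qed

text \<open>Since \<open>\<nu>\<^sup>+\<close> and \<open>\<nu>\<^sup>-\<close> are at most
  \<open>C\<close> times \<open>\<mu>\<close>, a set of \<open>\<mu>\<close>-measure below
  \<open>m / (2 * C)\<close> carries less than half of the mass \<open>m\<close>. For each target
  \<open>A\<close>, one of the two sets controlled by \<open>\<delta>\<close> is that small, which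
  costs at least \<open>\<delta> * (m / 2)\<close>, uniformly in \<open>\<nu>\<close>.\<close>

lemma pos_var_kernel_op_decrease:
  assumes \<mu>: "prob_signed_measure \<mu>" and "0 < C" "0 < m"
  shows "\<exists>\<eta>>0. \<forall>\<nu>. signed_measure \<nu> \<longrightarrow> \<nu> UNIV = 0 \<longrightarrow> (\<forall>A\<in>sets borel. \<bar>\<nu> A\<bar> \<le> C * \<mu> A) \<longrightarrow>
    m \<le> pos_var \<nu> UNIV \<longrightarrow> pos_var (kernel_op p \<nu>) UNIV \<le> pos_var \<nu> UNIV - \<eta>"
proof -
  obtain \<delta> where "0 < \<delta>" and
    \<delta>: "\<And>A. A \<in> sets borel \<Longrightarrow> \<mu> {x. p x A \<le> \<delta>} < m / (2 * C) \<or> \<mu> {x. 1 - \<delta> \<le> p x A} < m / (2 * C)"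
    using no_uniformly_separating_sets[OF \<mu>, of "m / (2 * C)"] \<open>0 < C\<close> \<open>0 < m\<close> by auto
  \<comment> \<open>Used twice: for \<open>- \<nu>\<close> with \<open>f x = p x A\<close>, and for
    \<open>\<nu>\<close> with \<open>f x = 1 - p x A\<close>.\<close>
  have half: "\<delta> * (m / 2) \<le> (\<integral>x. f x \<partial>pos_var_measure \<rho>)"
    if \<rho>: "signed_measure \<rho>" "\<And>A. A \<in> sets borel \<Longrightarrow> \<rho> A \<le> C * \<mu> A" "m \<le> pos_var \<rho> UNIV"
      and f: "f \<in> borel_measurable borel" "\<And>x. 0 \<le> f x" "\<And>x. f x \<le> 1"
      and small: "\<mu> {x. f x \<le> \<delta>} < m / (2 * C)" for \<rho> f
  proof -
    have S: "{x. f x \<le> \<delta>} \<in> sets borel" using f(1) by measurable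
    have "pos_var \<rho> {x. f x \<le> \<delta>} \<le> C * \<mu> {x. f x \<le> \<delta>}"
    proof (rule pos_var_least)
      fix B assume B: "B \<in> sets borel" "B \<subseteq> {x. f x \<le> \<delta>}"
      have "\<mu> B \<le> \<mu> {x. f x \<le> \<delta>}"
        using pos_var_upper[OF prob_signed_measureD(1)[OF \<mu>] B]
          pos_var_of_nonneg[OF prob_signed_measureD(1,2)[OF \<mu>] S] by simp
      then show "\<rho> B \<le> C * \<mu> {x. f x \<le> \<delta>}"
        using \<rho>(2)[OF B(1)] \<open>0 < C\<close> by (meson mult_left_mono less_imp_le order_trans)
    qed
    also have "\<dots> \<le> m / 2" using small \<open>0 < C\<close> by (simp add: field_simps)
    finally have "\<delta> * (m / 2) \<le> \<delta> * (pos_var \<rho> UNIV - pos_var \<rho> {x. f x \<le> \<delta>})"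
      using \<rho>(3) \<open>0 < \<delta>\<close> by (intro mult_left_mono) auto
    then show ?thesis using integral_pos_var_measure_ge[OF \<rho>(1) f, of \<delta>] by linarith
  qed
  have "pos_var (kernel_op p \<nu>) UNIV \<le> pos_var \<nu> UNIV - \<delta> * (m / 2)"
    if \<nu>: "signed_measure \<nu>" and "\<nu> UNIV = 0" and bd: "\<forall>A\<in>sets borel. \<bar>\<nu> A\<bar> \<le> C * \<mu> A"
      and m: "m \<le> pos_var \<nu> UNIV" for \<nu>
  proof (rule pos_var_least)
    fix A :: "'a set" assume A: "A \<in> sets borel"
    have \<nu>': "signed_measure (\<lambda>A. - \<nu> A)" using \<nu> by (rule signed_measure_minus)
    have bd': "\<nu> B \<le> C * \<mu> B" "- \<nu> B \<le> C * \<mu> B" if "B \<in> sets borel" for B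
      using bd[rule_format, OF that] by linarith+
    have m': "m \<le> pos_var (\<lambda>A. - \<nu> A) UNIV"
      using m \<open>\<nu> UNIV = 0\<close> by (simp add: pos_var_minus[OF \<nu>])
    interpret finite_measure "pos_var_measure \<nu>"
      by (rule finite_measure_pos_var_measure[OF \<nu>])
    \<comment> \<open>In the first case \<open>\<nu>\<^sup>-\<close> transports at least
      \<open>\<delta> * (m / 2)\<close> into \<open>A\<close>, which is subtracted; in the second
      \<open>\<nu>\<^sup>+\<close> leaves at least that much outside \<open>A\<close>.\<close>
    from \<delta>[OF A] show "kernel_op p \<nu> A \<le> pos_var \<nu> UNIV - \<delta> * (m / 2)"
    proof
      assume "\<mu> {x. p x A \<le> \<delta>} < m / (2 * C)"
      then have "\<delta> * (m / 2) \<le> (\<integral>x. p x A \<partial>pos_var_measure (\<lambda>A. - \<nu> A))"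
        using \<nu>' m' bd' A by (intro half) (auto simp: p_nonneg p_le_1)
      then show ?thesis
        using integral_p_le[OF \<nu> A] by (simp add: kernel_op_def signed_integral_def)
    next
      assume "\<mu> {x. 1 - \<delta> \<le> p x A} < m / (2 * C)"
      moreover have "{x. 1 - \<delta> \<le> p x A} = {x. 1 - p x A \<le> \<delta>}" by auto
      ultimately have "\<delta> * (m / 2) \<le> (\<integral>x. 1 - p x A \<partial>pos_var_measure \<nu>)"
        using \<nu> m bd' A by (intro half) (auto simp: p_nonneg p_le_1)
      also have "\<dots> = pos_var \<nu> UNIV - (\<integral>x. p x A \<partial>pos_var_measure \<nu>)"
        using integrable_p[OF \<nu> A] measure_pos_var_measure[OF \<nu>, of UNIV] by simp
      finally show ?thesis using kernel_op_le_pos_part[OF \<nu> A] by linarith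
    qed
  qed
  then show ?thesis
    using \<open>0 < \<delta>\<close> \<open>0 < m\<close> by (intro exI[of _ "\<delta> * (m / 2)"]) simp
qed

text \<open>A nonincreasing sequence that drops by a fixed amount while it stays above
  \<open>m\<close> must fall below every \<open>m > 0\<close>. The iterates are given as a sequence
  linked on Borel sets only, since the semigroup law is available only there.\<close>

lemma pos_var_iterates_tendsto_0:
  fixes \<nu> :: "nat \<Rightarrow> 'a set \<Rightarrow> real"
  assumes \<mu>: "prob_signed_measure \<mu>" and inv: "\<And>A. A \<in> sets borel \<Longrightarrow> kernel_op p \<mu> A = \<mu> A"
    and \<nu>: "\<And>n. signed_measure (\<nu> n)"
    and step: "\<And>n A. A \<in> sets borel \<Longrightarrow> \<nu> (Suc n) A = kernel_op p (\<nu> n) A"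
    and "\<nu> 0 UNIV = 0" and "0 < C" and bd0: "\<And>A. A \<in> sets borel \<Longrightarrow> \<bar>\<nu> 0 A\<bar> \<le> C * \<mu> A"
  shows "(\<lambda>n. pos_var (\<nu> n) UNIV) \<longlonglongrightarrow> 0"
proof -
  note \<mu>s = prob_signed_measureD(1)[OF \<mu>]
  have mass: "\<nu> n UNIV = 0" for n
    by (induction n) (simp_all add: \<open>\<nu> 0 UNIV = 0\<close> step kernel_op_UNIV[OF \<nu>])
  have bd: "\<forall>A\<in>sets borel. \<bar>\<nu> n A\<bar> \<le> C * \<mu> A" for n
  proof (induction n)
    case 0
    then show ?case using bd0 by blast
  next
    case (Suc n)
    show ?case
    proof
      fix A :: "'a set" assume A: "A \<in> sets borel"
      \<comment> \<open>Domination survives a step because the operator is positive and fixes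
        \<open>\<mu>\<close>: it maps the nonnegative measures \<open>C * \<mu> + \<nu> n\<close>
        and \<open>C * \<mu> - \<nu> n\<close> to nonnegative ones.\<close>
      have "0 \<le> kernel_op p (\<lambda>A. C * \<mu> A + b * \<nu> n A) A" if "b = 1 \<or> b = - 1" for b
      proof (rule kernel_op_nonneg[OF signed_measure_lincomb[OF \<mu>s \<nu>] _ A])
        fix A :: "'a set" assume "A \<in> sets borel"
        then have "\<bar>\<nu> n A\<bar> \<le> C * \<mu> A" using Suc.IH by blast
        then show "0 \<le> C * \<mu> A + b * \<nu> n A" using that by (auto simp: abs_le_iff)
      qed
      from this[of 1] this[of "- 1"] show "\<bar>\<nu> (Suc n) A\<bar> \<le> C * \<mu> A"
        unfolding kernel_op_lincomb[OF \<mu>s \<nu> A] inv[OF A] step[OF A] abs_le_iff by simp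
    qed
  qed
  let ?d = "\<lambda>n. pos_var (\<nu> n) UNIV"
  have d_Suc: "?d (Suc n) = pos_var (kernel_op p (\<nu> n)) UNIV" for n
    using pos_var_cong[of "\<nu> (Suc n)" "kernel_op p (\<nu> n)"] step by simp
  have dec: "?d n \<le> ?d m" if "m \<le> n" for m n
    by (rule lift_Suc_antimono_le[OF _ that]) (simp add: d_Suc pos_var_kernel_op_le[OF \<nu>])
  have small: "\<exists>n. ?d n < m" if "0 < m" for m
  proof (rule ccontr)
    assume "\<not> (\<exists>n. ?d n < m)"
    then have ge: "m \<le> ?d n" for n by (meson not_le)
    \<comment> \<open>The drop depends on \<open>C\<close> and \<open>m\<close> alone, so one
      \<open>\<eta>\<close> serves all iterates.\<close>
    have "\<exists>\<eta>>0. \<forall>n. ?d (Suc n) \<le> ?d n - \<eta>"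
      using pos_var_kernel_op_decrease[OF \<mu> \<open>0 < C\<close> \<open>0 < m\<close>]
      by (elim ex_forward conj_forward) (simp_all add: d_Suc \<nu> mass bd ge)
    then obtain \<eta> where "0 < \<eta>" and \<eta>: "\<And>n. ?d (Suc n) \<le> ?d n - \<eta>" by auto
    have lin: "?d n \<le> ?d 0 - real n * \<eta>" for n
    proof (induction n)
      case (Suc n)
      then show ?case using \<eta>[of n] by (simp add: algebra_simps)
    qed simp
    obtain n where "?d 0 < real n * \<eta>" using \<open>0 < \<eta>\<close> reals_Archimedean3 by blast
    then show False using lin[of n] pos_var_nonneg[OF \<nu>[of n], of UNIV] by linarith
  qed
  show ?thesis
  proof (rule LIMSEQ_I)
    fix r :: real assume "0 < r"
    then obtain n where "?d n < r" using small by blast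
    then have "norm (?d k - 0) < r" if "n \<le> k" for k
      using dec[OF that] pos_var_nonneg[OF \<nu>[of k], of UNIV] by simp
    then show "\<exists>no. \<forall>k\<ge>no. norm (?d k - 0) < r" by blast
  qed
qed

end

section \<open>Convergence of regular semigroups\<close>

lemma pos_var_absolutely_continuous:
  assumes \<mu>: "prob_signed_measure \<mu>" and ac: "\<And>A. A \<in> sets borel \<Longrightarrow> \<mu> A = 0 \<Longrightarrow> \<rho> A = 0"
    and \<rho>: "signed_measure \<rho>" and A: "A \<in> sets borel" "\<mu> A = 0"
  shows "pos_var \<rho> A = 0"
proof (intro antisym pos_var_nonneg[OF \<rho>] pos_var_least)
  fix B assume B: "B \<in> sets borel" "B \<subseteq> A"
  have "\<mu> B \<le> \<mu> A"
    using pos_var_upper[OF prob_signed_measureD(1)[OF \<mu>] B]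
      pos_var_of_nonneg[OF prob_signed_measureD(1,2)[OF \<mu>] A(1)] by simp
  then have "\<mu> B = 0" using prob_signed_measureD(2)[OF \<mu> B(1)] A(2) by simp
  then show "\<rho> B \<le> 0" using ac[OF B(1)] by simp
qed

text \<open>\<open>f\<close> is the Radon-Nikodym density of \<open>\<rho>\<^sup>+\<close> with
  respect to \<open>\<mu>\<close>, finite almost everywhere because \<open>\<rho>\<^sup>+\<close> is
  finite. Only the estimate on sets where \<open>f\<close> is bounded is exported, which keeps
  integrals out of the truncation.\<close>

lemma pos_var_density:
  assumes \<mu>: "prob_signed_measure \<mu>" and ac: "\<And>A. A \<in> sets borel \<Longrightarrow> \<mu> A = 0 \<Longrightarrow> \<rho> A = 0"
    and \<rho>: "signed_measure \<rho>"
  obtains f :: "'a::topological_space \<Rightarrow> ennreal" where "f \<in> borel_measurable borel" "\<mu> {x. f x = \<infinity>} = 0"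
    "\<And>A n. A \<in> sets borel \<Longrightarrow> (\<And>x. x \<in> A \<Longrightarrow> f x \<le> of_nat n) \<Longrightarrow> pos_var \<rho> A \<le> real n * \<mu> A"
proof -
  let ?M = "pos_var_measure \<mu>" and ?R = "pos_var_measure \<rho>"
  interpret M: finite_measure ?M
    by (rule finite_measure_pos_var_measure[OF prob_signed_measureD(1)[OF \<mu>]])
  interpret R: finite_measure ?R by (rule finite_measure_pos_var_measure[OF \<rho>])
  have M: "emeasure ?M A = ennreal (\<mu> A)" if "A \<in> sets borel" for A
    using that by (simp add: M.emeasure_eq_measure measure_prob_signed_measure[OF \<mu>])
  have "absolutely_continuous ?M ?R"
    unfolding absolutely_continuous_def
  proof
    fix A assume "A \<in> null_sets ?M"
    then have A: "A \<in> sets borel" "\<mu> A = 0"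
      using M[of A] prob_signed_measureD(2)[OF \<mu>, of A] by (auto simp: null_sets_def)
    then show "A \<in> null_sets ?R"
      using pos_var_absolutely_continuous[OF \<mu> ac \<rho> A] emeasure_pos_var_measure[OF \<rho>]
      by (auto simp: null_sets_def)
  qed
  then obtain f where f: "f \<in> borel_measurable ?M" "density ?M f = ?R"
    using M.Radon_Nikodym_finite_measure[OF R.finite_measure_axioms] by auto
  then have f' [measurable]: "f \<in> borel_measurable borel" by simp
  have R: "emeasure ?R A = (\<integral>\<^sup>+x. f x * indicator A x \<partial>?M)" if "A \<in> sets borel" for A
    using that f(1) unfolding f(2)[symmetric] by (intro emeasure_density) auto
  have "(\<integral>\<^sup>+x. f x \<partial>?M) \<noteq> \<infinity>"
    using R[of UNIV] R.emeasure_finite[of UNIV] by simp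
  then have "AE x in ?M. f x \<noteq> \<infinity>" by (intro nn_integral_PInf_AE f(1))
  then have "emeasure ?M {x. f x = \<infinity>} = 0"
    by (subst (asm) AE_iff_measurable[where N = "{x. f x = \<infinity>}"]) auto
  then have "\<mu> {x. f x = \<infinity>} = 0"
    using M[of "{x. f x = \<infinity>}"] prob_signed_measureD(2)[OF \<mu>, of "{x. f x = \<infinity>}"] by simp
  moreover have "pos_var \<rho> A \<le> real n * \<mu> A"
    if A: "A \<in> sets borel" and le: "\<And>x. x \<in> A \<Longrightarrow> f x \<le> of_nat n" for A n
  proof -
    have "emeasure ?R A \<le> (\<integral>\<^sup>+x. of_nat n * indicator A x \<partial>?M)"
      unfolding R[OF A] using le by (intro nn_integral_mono) (auto simp: indicator_def)
    also have "\<dots> = of_nat n * emeasure ?M A" using A by (simp add: nn_integral_cmult_indicator)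
    also have "\<dots> = ennreal (real n * \<mu> A)"
      using prob_signed_measureD(2)[OF \<mu> A]
      by (simp add: M[OF A] ennreal_mult ennreal_of_nat_eq_real_of_nat)
    finally show ?thesis
      using prob_signed_measureD(2)[OF \<mu> A] by (simp add: emeasure_pos_var_measure[OF \<rho> A])
  qed
  ultimately show ?thesis using that f' by blast
qed

text \<open>Restrict \<open>\<rho>\<close> to the set \<open>S n\<close> where the densities of both
  Jordan parts are at most \<open>n\<close>, then subtract \<open>\<rho> (S n)\<close> times
  \<open>\<mu>\<close> to restore total mass 0. The error is governed by the mass of
  \<open>\<rho>\<close> outside \<open>S n\<close>.\<close>

lemma approx_by_bounded_density:
  assumes \<mu>: "prob_signed_measure \<mu>" and ac: "\<And>A. A \<in> sets borel \<Longrightarrow> \<mu> A = 0 \<Longrightarrow> \<rho> A = 0"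
    and \<rho>: "signed_measure \<rho>" and "\<rho> UNIV = 0" and "0 < \<epsilon>"
  obtains \<rho>' C where "signed_measure \<rho>'" "\<rho>' UNIV = 0" "0 < C"
    "\<And>A. A \<in> sets borel \<Longrightarrow> \<bar>\<rho>' A\<bar> \<le> C * \<mu> A" "pos_var (\<lambda>A. \<rho> A - \<rho>' A) UNIV \<le> \<epsilon>"
proof -
  let ?\<rho>' = "\<lambda>A. - \<rho> A"
  note \<mu>D = prob_signed_measureD[OF \<mu>]
  have \<rho>': "signed_measure ?\<rho>'" using \<rho> by (rule signed_measure_minus)
  have ac': "?\<rho>' A = 0" if "A \<in> sets borel" "\<mu> A = 0" for A using ac that by simp
  obtain f :: "'a \<Rightarrow> ennreal" where f [measurable]: "f \<in> borel_measurable borel"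
    and f_inf: "\<mu> {x. f x = \<infinity>} = 0"
    and f_le: "\<And>A n. A \<in> sets borel \<Longrightarrow> (\<And>x. x \<in> A \<Longrightarrow> f x \<le> of_nat n) \<Longrightarrow> pos_var \<rho> A \<le> real n * \<mu> A"
    using pos_var_density[of \<mu> \<rho>, OF \<mu> ac \<rho>] by blast
  obtain g :: "'a \<Rightarrow> ennreal" where g [measurable]: "g \<in> borel_measurable borel"
    and g_inf: "\<mu> {x. g x = \<infinity>} = 0"
    and g_le: "\<And>A n. A \<in> sets borel \<Longrightarrow> (\<And>x. x \<in> A \<Longrightarrow> g x \<le> of_nat n) \<Longrightarrow> pos_var ?\<rho>' A \<le> real n * \<mu> A"
    using pos_var_density[of \<mu> ?\<rho>', OF \<mu> ac' \<rho>'] by blast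
  define S where "S n = {x. f x \<le> of_nat n \<and> g x \<le> of_nat n}" for n :: nat
  have S [measurable]: "S n \<in> sets borel" for n unfolding S_def by measurable
  have Sc: "- S n \<in> sets borel" for n by (metis S borel_comp)
  have dec: "decseq (\<lambda>n. - S n)"
    unfolding decseq_def S_def by (auto intro: order_trans[OF _ of_nat_mono])
  have inter: "(\<Inter>n. - S n) \<subseteq> {x. f x = \<infinity>} \<union> {x. g x = \<infinity>}"
  proof
    fix x assume x: "x \<in> (\<Inter>n. - S n)"
    show "x \<in> {x. f x = \<infinity>} \<union> {x. g x = \<infinity>}"
    proof (rule ccontr)
      assume "\<not> ?thesis"
      then have "max (f x) (g x) < top" by (auto simp: max_def less_top)
      then obtain n :: nat where "max (f x) (g x) < of_nat n"
        using ennreal_Ex_less_of_nat by blast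
      then have "x \<in> S n" by (simp add: S_def less_imp_le)
      then show False using x by blast
    qed
  qed
  \<comment> \<open>The sets \<open>- S n\<close> decrease to a set on which one of the densities is
    infinite, hence to a null set of the positive variation of \<open>\<tau>\<close>.\<close>
  have tail: "(\<lambda>n. pos_var \<tau> (- S n)) \<longlonglongrightarrow> 0"
    if \<tau>: "signed_measure \<tau>" "\<And>A. A \<in> sets borel \<Longrightarrow> \<mu> A = 0 \<Longrightarrow> \<tau> A = 0" for \<tau>
  proof -
    interpret T: finite_measure "pos_var_measure \<tau>"
      by (rule finite_measure_pos_var_measure[OF \<tau>(1)])
    have I: "(\<Inter>n. - S n) \<in> sets borel" using Sc by (intro sets.countable_INT') auto
    have "{x. f x = \<infinity>} \<in> null_sets (pos_var_measure \<tau>)" "{x. g x = \<infinity>} \<in> null_sets (pos_var_measure \<tau>)"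
      using pos_var_absolutely_continuous[OF \<mu> \<tau>(2,1) _ f_inf]
        pos_var_absolutely_continuous[OF \<mu> \<tau>(2,1) _ g_inf]
      by (auto simp: null_sets_def emeasure_pos_var_measure[OF \<tau>(1)])
    then have "(\<Inter>n. - S n) \<in> null_sets (pos_var_measure \<tau>)"
      using I by (intro null_sets_subset[OF null_sets.Un _ inter]) auto
    then have "measure (pos_var_measure \<tau>) (\<Inter>n. - S n) = 0" by (rule measure_eq_0_null_sets)
    moreover have "(\<lambda>n. measure (pos_var_measure \<tau>) (- S n)) \<longlonglongrightarrow> measure (pos_var_measure \<tau>) (\<Inter>n. - S n)"
      using Sc dec by (intro T.finite_Lim_measure_decseq) auto
    ultimately show ?thesis using Sc by (simp add: measure_pos_var_measure[OF \<tau>(1)])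
  qed
  \<comment> \<open>The weights anticipate the final estimate: \<open>\<rho>\<^sup>+\<close> of
    \<open>- S n\<close> enters once through the discarded part and once, together with
    \<open>\<rho>\<^sup>-\<close>, through the correction
    \<open>\<bar>\<rho> (S n)\<bar> = \<bar>\<rho> (- S n)\<bar>\<close>.\<close>
  have "(\<lambda>n. 2 * pos_var \<rho> (- S n) + pos_var ?\<rho>' (- S n)) \<longlonglongrightarrow> 2 * 0 + 0"
    by (intro tendsto_intros tail \<rho> \<rho>') (auto simp: ac)
  then have "eventually (\<lambda>n. 2 * pos_var \<rho> (- S n) + pos_var ?\<rho>' (- S n) < \<epsilon>) sequentially"
    using \<open>0 < \<epsilon>\<close> by (auto dest: order_tendstoD(2))
  then obtain n where n: "2 * pos_var \<rho> (- S n) + pos_var ?\<rho>' (- S n) < \<epsilon>"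
    by (auto simp: eventually_sequentially)
  define \<sigma> where "\<sigma> A = \<rho> (A \<inter> S n) - \<rho> (S n) * \<mu> A" for A
  have "signed_measure (\<lambda>A. \<rho> (A \<inter> S n))"
    unfolding signed_measure_def
  proof (intro conjI allI impI)
    fix A :: "nat \<Rightarrow> 'a set" assume A: "range A \<subseteq> sets borel" "disjoint_family A"
    have "(\<lambda>i. \<rho> (A i \<inter> S n)) sums \<rho> (\<Union>i. A i \<inter> S n)"
      using A by (intro signed_measure_sums[OF \<rho>] disjoint_family_subset[OF A(2)] sets.Int S) auto
    then show "(\<lambda>i. \<rho> (A i \<inter> S n)) sums \<rho> ((\<Union>i. A i) \<inter> S n)" by (simp add: Int_UN_distrib2)
  qed (simp add: signed_measure_empty[OF \<rho>])
  from signed_measure_lincomb[OF this \<mu>D(1), of 1 "- \<rho> (S n)"]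
  have "signed_measure \<sigma>" by (simp add: \<sigma>_def[abs_def])
  moreover have "\<sigma> UNIV = 0" by (simp add: \<sigma>_def \<mu>D(3))
  \<comment> \<open>The summand 1 keeps the constant positive even if \<open>n\<close> and
    \<open>\<rho> (S n)\<close> are both 0.\<close>
  moreover have "0 < real n + \<bar>\<rho> (S n)\<bar> + 1" by simp
  moreover have "\<bar>\<sigma> A\<bar> \<le> (real n + \<bar>\<rho> (S n)\<bar> + 1) * \<mu> A" if A: "A \<in> sets borel" for A
  proof -
    have AS: "A \<inter> S n \<in> sets borel" using A by simp
    have "pos_var \<rho> (A \<inter> S n) \<le> real n * \<mu> (A \<inter> S n)" "pos_var ?\<rho>' (A \<inter> S n) \<le> real n * \<mu> (A \<inter> S n)"
      using AS by (auto intro!: f_le g_le simp: S_def)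
    then have "\<bar>\<rho> (A \<inter> S n)\<bar> \<le> real n * \<mu> (A \<inter> S n)"
      using pos_var_upper[OF \<rho> AS order_refl] pos_var_upper[OF \<rho>' AS order_refl] by linarith
    also have "\<dots> \<le> real n * \<mu> A"
      using pos_var_upper[OF \<mu>D(1) AS, of A] pos_var_of_nonneg[OF \<mu>D(1,2) A]
      by (intro mult_left_mono) auto
    moreover have "\<bar>\<rho> (S n) * \<mu> A\<bar> = \<bar>\<rho> (S n)\<bar> * \<mu> A" using \<mu>D(2)[OF A] by (simp add: abs_mult)
    ultimately show ?thesis
      using \<mu>D(2)[OF A] abs_triangle_ineq4[of "\<rho> (A \<inter> S n)" "\<rho> (S n) * \<mu> A"]
      unfolding \<sigma>_def distrib_right by linarith
  qed
  moreover have "pos_var (\<lambda>A. \<rho> A - \<sigma> A) UNIV \<le> \<epsilon>"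
  proof (rule pos_var_least)
    fix A :: "'a set" assume A: "A \<in> sets borel"
    have "\<rho> (A - A \<inter> S n) = \<rho> A - \<rho> (A \<inter> S n)" using A by (intro signed_measure_Diff[OF \<rho>]) auto
    moreover have "\<rho> (A - A \<inter> S n) \<le> pos_var \<rho> (- S n)" using A by (intro pos_var_upper[OF \<rho>]) auto
    moreover have "\<bar>\<rho> (S n)\<bar> \<le> pos_var \<rho> (- S n) + pos_var ?\<rho>' (- S n)"
    proof -
      have "\<rho> (- S n) = - \<rho> (S n)"
        using signed_measure_Diff[OF \<rho>, of UNIV "S n"] \<open>\<rho> UNIV = 0\<close> by (simp add: Compl_eq_Diff_UNIV)
      then show ?thesis
        using pos_var_upper[OF \<rho> Sc order_refl, of n] pos_var_upper[OF \<rho>' Sc order_refl, of n]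
          pos_var_nonneg[OF \<rho>, of "- S n"] pos_var_nonneg[OF \<rho>', of "- S n"] by linarith
    qed
    moreover have "\<rho> (S n) * \<mu> A \<le> \<bar>\<rho> (S n)\<bar> * 1"
      using \<mu>D(2,4)[OF A] by (intro mult_mono) auto
    ultimately show "\<rho> A - \<sigma> A \<le> \<epsilon>" using n unfolding \<sigma>_def by linarith
  qed
  ultimately show ?thesis by (rule that)
qed

theorem theorem4p4:
  fixes k :: "real \<Rightarrow> 'a::polish_space \<Rightarrow> 'a set \<Rightarrow> real"
    and \<mu> :: "'a set \<Rightarrow> real"
    and t0 :: real
  assumes "kernel_semigroup k"
    and "markovian k"
    and "stoch_continuous k"
    and "prob_signed_measure \<mu>"
    and "invariant_measure k \<mu>"
    and "t0 > 0"
    and "regular_at k t0"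
  shows "(\<forall>\<nu>. signed_measure \<nu> \<longrightarrow>
            ((\<lambda>t. tv_norm (\<lambda>A. kernel_op (k t) \<nu> A - \<nu> UNIV * \<mu> A)) \<longlongrightarrow> 0) at_top)
       \<and> (\<forall>\<mu>'. prob_signed_measure \<mu>' \<and> invariant_measure k \<mu>' \<longrightarrow>
            (\<forall>A \<in> sets borel. \<mu>' A = \<mu> A))
       \<and> (\<forall>t\<ge>t0. \<forall>x. equivalent_measures \<mu> (k t x))"
proof -
  have mk: "markov_kernel (k t)" if "0 \<le> t" for t
    using assms(1,2) that
    by unfold_locales (auto simp: markovian_def kernel_semigroup_def bounded_kernel_def)
  interpret P: regular_kernel "k t0"
    using mk[of t0] assms(6,7) unfolding regular_kernel_def regular_kernel_axioms_def regular_at_def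
    by simp
  have T0: "kernel_op (k 0) \<nu> A = \<nu> A" if "signed_measure \<nu>" "A \<in> sets borel" for \<nu> A
    using assms(1) that by (simp add: kernel_semigroup_def)
  have Tadd: "kernel_op (k (t + s)) \<nu> A = kernel_op (k t) (kernel_op (k s) \<nu>) A"
    if "0 \<le> t" "0 \<le> s" "signed_measure \<nu>" "A \<in> sets borel" for t s \<nu> A
    using assms(1) that by (simp add: kernel_semigroup_def)
  have inv: "kernel_op (k t) \<mu> A = \<mu> A" if "0 \<le> t" "A \<in> sets borel" for t A
    using assms(5) that by (simp add: invariant_measure_def)
  note \<mu> = assms(4)
  note \<mu>s = prob_signed_measureD(1)[OF \<mu>]
  \<comment> \<open>By invariance \<open>\<mu>\<close> is itself the image of a probability measure
    under the regular kernel.\<close>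
  have null: "\<mu> A = 0 \<longleftrightarrow> k t0 x A = 0" if "A \<in> sets borel" for A x
    using P.kernel_op_eq_0_iff[OF \<mu> that] inv[of t0 A] that \<open>0 < t0\<close> by simp
  have equiv: "equivalent_measures \<mu> (k t x)" if "t0 \<le> t" for t x
    unfolding equivalent_measures_def
  proof
    fix A :: "'a set" assume A: "A \<in> sets borel"
    interpret Q: markov_kernel "k (t - t0)" using that by (intro mk) simp
    interpret R: markov_kernel "k t" using that \<open>0 < t0\<close> by (intro mk) simp
    \<comment> \<open>Splitting off the last time span \<open>t0\<close> exhibits
      \<open>k t x\<close> as the image of the probability measure \<open>k (t - t0) x\<close> under
      the regular kernel.\<close>
    have "k t x A = kernel_op (k (t0 + (t - t0))) (\<lambda>A. indicator A x) A"
      using R.kernel_op_dirac[OF A] by simp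
    also have "\<dots> = kernel_op (k t0) (kernel_op (k (t - t0)) (\<lambda>A. indicator A x)) A"
      using that \<open>0 < t0\<close> A by (intro Tadd signed_measure_dirac) auto
    also have "\<dots> = kernel_op (k t0) (k (t - t0) x) A"
      unfolding kernel_op_def[of "k t0"] by (intro signed_integral_cong_measure Q.kernel_op_dirac)
    finally show "\<mu> A = 0 \<longleftrightarrow> k t x A = 0"
      using P.kernel_op_eq_0_iff[OF Q.prob A] null[OF A] by simp
  qed
  \<comment> \<open>Monotonicity in time lets smallness at one multiple of \<open>t0\<close> persist
    at all later real times.\<close>
  have antimono: "pos_var (kernel_op (k t) \<nu>) UNIV \<le> pos_var (kernel_op (k s) \<nu>) UNIV"
    if \<nu>: "signed_measure \<nu>" and st: "0 \<le> s" "s \<le> t" for \<nu> s t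
  proof -
    interpret Q: markov_kernel "k (t - s)" using st by (intro mk) simp
    interpret R: markov_kernel "k s" using st by (intro mk)
    have "pos_var (kernel_op (k t) \<nu>) = pos_var (kernel_op (k (t - s)) (kernel_op (k s) \<nu>))"
      using Tadd[of "t - s" s \<nu>] \<nu> st by (intro pos_var_cong) simp
    then show ?thesis using Q.pos_var_kernel_op_le[OF R.signed_measure_kernel_op[OF \<nu>]] by simp
  qed
  have bounded: "\<exists>s\<ge>0. pos_var (kernel_op (k s) \<nu>) UNIV < \<epsilon>"
    if \<nu>: "signed_measure \<nu>" "\<nu> UNIV = 0" and C: "0 < C" "\<And>A. A \<in> sets borel \<Longrightarrow> \<bar>\<nu> A\<bar> \<le> C * \<mu> A"
      and "0 < \<epsilon>" for \<nu> C \<epsilon>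
  proof -
    have "(\<lambda>n. pos_var (kernel_op (k (real n * t0)) \<nu>) UNIV) \<longlonglongrightarrow> 0"
    proof (rule P.pos_var_iterates_tendsto_0[OF \<mu> _ _ _ _ C(1)])
      show "signed_measure (kernel_op (k (real n * t0)) \<nu>)" for n
        using \<open>0 < t0\<close> \<nu>(1) by (intro markov_kernel.signed_measure_kernel_op mk) auto
      show "kernel_op (k (real (Suc n) * t0)) \<nu> A = kernel_op (k t0) (kernel_op (k (real n * t0)) \<nu>) A"
        if "A \<in> sets borel" for n A
        using Tadd[of t0 "real n * t0" \<nu> A] \<open>0 < t0\<close> \<nu>(1) that by (simp add: algebra_simps)
    qed (use inv \<open>0 < t0\<close> \<nu> C T0 in auto)
    then have "eventually (\<lambda>n. pos_var (kernel_op (k (real n * t0)) \<nu>) UNIV < \<epsilon>) sequentially"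
      using \<open>0 < \<epsilon>\<close> by (rule order_tendstoD(2))
    then obtain n where "pos_var (kernel_op (k (real n * t0)) \<nu>) UNIV < \<epsilon>"
      by (auto simp: eventually_sequentially)
    then show ?thesis using \<open>0 < t0\<close> by (intro exI[of _ "real n * t0"]) simp
  qed
  have ac_tendsto: "((\<lambda>t. pos_var (kernel_op (k t) \<rho>) UNIV) \<longlongrightarrow> 0) at_top"
    if \<rho>: "signed_measure \<rho>" "\<rho> UNIV = 0" and ac: "\<And>A. A \<in> sets borel \<Longrightarrow> \<mu> A = 0 \<Longrightarrow> \<rho> A = 0" for \<rho>
  proof (rule tendstoI)
    fix \<epsilon> :: real assume "0 < \<epsilon>"
    then have "0 < \<epsilon> / 2" by simp
    \<comment> \<open>One half of \<open>\<epsilon>\<close> pays for the truncation error, which the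
      contraction never enlarges; the other pays for the decay of \<open>\<sigma>\<close>, which
      lasts from time \<open>s\<close> on.\<close>
    obtain \<sigma> C where \<sigma>: "signed_measure \<sigma>" "\<sigma> UNIV = 0" "0 < C"
      "\<And>A. A \<in> sets borel \<Longrightarrow> \<bar>\<sigma> A\<bar> \<le> C * \<mu> A" "pos_var (\<lambda>A. \<rho> A - \<sigma> A) UNIV \<le> \<epsilon> / 2"
      using approx_by_bounded_density[of \<mu> \<rho>, OF \<mu> ac \<rho> \<open>0 < \<epsilon> / 2\<close>] by blast
    obtain s where s: "0 \<le> s" "pos_var (kernel_op (k s) \<sigma>) UNIV < \<epsilon> / 2"
      using bounded[OF \<sigma>(1-4) \<open>0 < \<epsilon> / 2\<close>] by blast
    have "dist (pos_var (kernel_op (k t) \<rho>) UNIV) 0 < \<epsilon>" if "s \<le> t" for t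
    proof -
      interpret Q: markov_kernel "k t" using that s(1) by (intro mk) simp
      have diff: "signed_measure (\<lambda>A. \<rho> A - \<sigma> A)"
        using signed_measure_lincomb[OF \<rho>(1) \<sigma>(1), of 1 "- 1"] by simp
      have "pos_var (kernel_op (k t) \<rho>) UNIV
          \<le> pos_var (kernel_op (k t) \<sigma>) UNIV + pos_var (kernel_op (k t) (\<lambda>A. \<rho> A - \<sigma> A)) UNIV"
      proof (rule pos_var_least)
        fix A :: "'a set" assume A: "A \<in> sets borel"
        have "kernel_op (k t) \<rho> A = kernel_op (k t) \<sigma> A + kernel_op (k t) (\<lambda>A. \<rho> A - \<sigma> A) A"
          using Q.kernel_op_diff[OF \<rho>(1) \<sigma>(1) A, of 1] by simp
        then show "kernel_op (k t) \<rho> A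
            \<le> pos_var (kernel_op (k t) \<sigma>) UNIV + pos_var (kernel_op (k t) (\<lambda>A. \<rho> A - \<sigma> A)) UNIV"
          using pos_var_upper[OF Q.signed_measure_kernel_op[OF \<sigma>(1)] A, of UNIV]
            pos_var_upper[OF Q.signed_measure_kernel_op[OF diff] A, of UNIV] by simp
      qed
      then have "pos_var (kernel_op (k t) \<rho>) UNIV < \<epsilon>"
        using Q.pos_var_kernel_op_le[OF diff] \<sigma>(5) antimono[OF \<sigma>(1) s(1) that] s(2) by simp
      then show ?thesis
        using pos_var_nonneg[OF Q.signed_measure_kernel_op[OF \<rho>(1)], of UNIV] by simp
    qed
    then show "eventually (\<lambda>t. dist (pos_var (kernel_op (k t) \<rho>) UNIV) 0 < \<epsilon>) at_top"
      by (auto simp: eventually_at_top_linorder)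
  qed
  have signed_diff: "signed_measure (\<lambda>A. kernel_op (k t) \<nu> A - \<nu> UNIV * \<mu> A)"
    "kernel_op (k t) \<nu> UNIV - \<nu> UNIV * \<mu> UNIV = 0"
    if "signed_measure \<nu>" "0 \<le> t" for \<nu> t
    using signed_measure_lincomb[OF markov_kernel.signed_measure_kernel_op[OF mk] \<mu>s, of t \<nu> 1 "- \<nu> UNIV"]
      markov_kernel.kernel_op_UNIV[OF mk] prob_signed_measureD(3)[OF \<mu>] that by simp_all
  have conv: "((\<lambda>t. tv_norm (\<lambda>A. kernel_op (k t) \<nu> A - \<nu> UNIV * \<mu> A)) \<longlongrightarrow> 0) at_top"
    if \<nu>: "signed_measure \<nu>" for \<nu>
  proof -
    \<comment> \<open>Running the semigroup for time \<open>t0\<close> first makes the difference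
      absolutely continuous with respect to \<open>\<mu>\<close>; afterwards the distance at time
      \<open>t\<close> is that of \<open>\<rho>\<close> evolved for \<open>t - t0\<close>.\<close>
    define \<rho> where "\<rho> A = kernel_op (k t0) \<nu> A - \<nu> UNIV * \<mu> A" for A
    have \<rho>: "signed_measure \<rho>" "\<rho> UNIV = 0"
      using signed_diff[OF \<nu>, of t0] \<open>0 < t0\<close> by (simp_all add: \<rho>_def[abs_def])
    \<comment> \<open>A \<open>\<mu>\<close>-null set is null for every \<open>k t0 x\<close>, so
      the integrand in \<open>kernel_op (k t0) \<nu> A\<close> is identically 0.\<close>
    have "\<rho> A = 0" if "A \<in> sets borel" "\<mu> A = 0" for A
      using null[OF that(1)] that(2) by (simp add: \<rho>_def kernel_op_def signed_integral_def)
    then have "((\<lambda>t. pos_var (kernel_op (k t) \<rho>) UNIV) \<longlongrightarrow> 0) at_top"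
      using \<rho> by (intro ac_tendsto)
    then have "((\<lambda>t. pos_var (kernel_op (k (t - t0)) \<rho>) UNIV) \<longlongrightarrow> 0) at_top"
      by (rule filterlim_compose)
        (simp add: filterlim_tendsto_add_at_top[OF tendsto_const filterlim_ident, of "- t0", simplified])
    then have lim: "((\<lambda>t. 2 * pos_var (kernel_op (k (t - t0)) \<rho>) UNIV) \<longlongrightarrow> 0) at_top"
      by (rule tendsto_mult_right_zero)
    have bounds: "0 \<le> tv_norm (\<lambda>A. kernel_op (k t) \<nu> A - \<nu> UNIV * \<mu> A)"
      "tv_norm (\<lambda>A. kernel_op (k t) \<nu> A - \<nu> UNIV * \<mu> A) \<le> 2 * pos_var (kernel_op (k (t - t0)) \<rho>) UNIV"
      if "t0 \<le> t" for t
    proof -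
      have t: "0 \<le> t" "0 \<le> t - t0" using that \<open>0 < t0\<close> by simp_all
      interpret Q: markov_kernel "k (t - t0)" using t(2) by (rule mk)
      have "kernel_op (k t) \<nu> A - \<nu> UNIV * \<mu> A = kernel_op (k (t - t0)) \<rho> A" if A: "A \<in> sets borel" for A
        using Q.kernel_op_diff[OF P.signed_measure_kernel_op[OF \<nu>] \<mu>s A, of "\<nu> UNIV"]
          Tadd[OF t(2) _ \<nu> A, of t0] inv[OF t(2) A] \<open>0 < t0\<close> by (simp add: \<rho>_def[abs_def])
      then have "pos_var (\<lambda>A. kernel_op (k t) \<nu> A - \<nu> UNIV * \<mu> A) = pos_var (kernel_op (k (t - t0)) \<rho>)"
        by (rule pos_var_cong)
      then show "0 \<le> tv_norm (\<lambda>A. kernel_op (k t) \<nu> A - \<nu> UNIV * \<mu> A)"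
        "tv_norm (\<lambda>A. kernel_op (k t) \<nu> A - \<nu> UNIV * \<mu> A) \<le> 2 * pos_var (kernel_op (k (t - t0)) \<rho>) UNIV"
        using tv_norm_bounds(1,2)[OF signed_diff[OF \<nu> t(1)]] by simp_all
    qed
    show ?thesis
      by (rule tendsto_sandwich[OF _ _ tendsto_const lim])
        (auto simp: eventually_at_top_linorder intro!: exI[of _ t0] bounds)
  qed
  have unique: "\<mu>' A = \<mu> A"
    if \<mu>': "prob_signed_measure \<mu>'" "invariant_measure k \<mu>'" and A: "A \<in> sets borel" for \<mu>' A
  proof -
    note \<mu>'D = prob_signed_measureD[OF \<mu>'(1)]
    \<comment> \<open>As \<open>\<mu>'\<close> is fixed by the semigroup, the left side is
      independent of \<open>t\<close> while the right side tends to 0.\<close>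
    have "\<bar>\<mu>' A - \<mu> A\<bar> \<le> tv_norm (\<lambda>A. kernel_op (k t) \<mu>' A - \<mu>' UNIV * \<mu> A)" if "0 \<le> t" for t
      using tv_norm_bounds(3)[OF signed_diff[OF \<mu>'D(1) that] A] \<mu>'(2) that A \<mu>'D(3)
      by (simp add: invariant_measure_def)
    then have "\<bar>\<mu>' A - \<mu> A\<bar> \<le> 0"
      by (intro tendsto_lowerbound[OF conv[OF \<mu>'D(1)]])
        (auto simp: eventually_at_top_linorder intro!: exI[of _ 0])
    then show ?thesis by simp
  qed
  show ?thesis using conv unique equiv by blast
qed

end
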